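(* Let $0<\alpha_1<\alpha_2$, let $\nu$ be an angular measure (a finite measure on $\mathbf{S}_+^{d-1}$ with $\int u^j\mathrm d\nu(u)=1$ for all $j$), and let $Z_i\sim\mathcal{MS}(\alpha_i,\nu)$ for $i=1,2$. Let $\zeta\sim\mathcal F(\alpha_1)$ be a scalar Fréchet random variable and $\mu_{\alpha_1}$ the exponent measure of $Z_1$. (1) There exists a constant $C^{\mathrm K}_{\alpha_1,\alpha_2,\nu}$ such that $$\mathrm d_{\mathrm K}(Z_1,Z_2)\le C^{\mathrm K}_{\alpha_1,\alpha_2,\nu}\Big(\frac1{\alpha_1}+\frac1{\alpha_2}\Big)|\alpha_1-\alpha_2|,$$ and a possible choice is $$C^{\mathrm K}_{\alpha_1,\alpha_2,\nu}=d+\sum_{j=1}^d\int_{E_0}|\log y^j|\;\mathbb{P}\big(\min(\zeta^{\alpha_2/\alpha_1},\zeta)\le y^j\big)\,\mathrm d\mu_{\alpha_1}(y).$$ (2) If furthermore $\alpha_1$ and $\alpha_2$ are both greater than $1$, there exists a constant $C^{\mathrm W}_{\alpha_1,\alpha_2,\nu}>0$ such that $$\mathrm d_{\mathrm W}(Z_1,Z_2)\le C^{\mathrm W}_{\alpha_1,\alpha_2,\nu}\Big(\frac1{\alpha_1}+\frac1{\alpha_2}\Big)|\alpha_1-\alpha_2|,$$ and a possible choice is $$C^{\mathrm W}_{\alpha_1,\alpha_2,\nu}=d\,\Gamma\Big(1-\frac1{\alpha_1}\Big)+\sum_{j=1}^d\int_{E_0}\max(1,y^j)\,|\log y^j|\;\mathbb{P}\big(\min(\zeta^{\alpha_2/\alpha_1},\zeta)\le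 y^j\big)\,\mathrm d\mu_{\alpha_1}(y).$$
   Context: Fix $d\ge 1$, $\mathbb{R}_+=[0,\infty)$. Operations on vectors (powers, inequalities) are coordinate-wise; $\|x\|_1=\sum_j|x^j|$. Let $E_0=[0,\infty)^d\setminus\{0\}$, $[0,x]=\prod_j[0,x^j]$ and $[0,x]^c$ its complement in $E_0$. Fix a norm $\|\cdot\|$ on $\mathbb{R}^d$ such that $\mathbf{S}_+^{d-1}=\{x\in\mathbb{R}_+^d:\|x\|=1\}\subseteq[0,1]^d$. For $\alpha>0$ and an angular measure $\nu$, the exponent measure $\mu_\alpha$ is the pushforward of $\alpha r^{-\alpha-1}\mathrm dr\otimes\nu(\mathrm du)$ on $(0,\infty)\times\mathbf{S}_+^{d-1}$ by $(r,u)\mapsto r\,u^{1/\alpha}$. $\mathcal{MS}(\alpha,\nu)$ is the law of the max-stable random vector $Z$ on $(0,\infty)^d$ with $\mathbb{P}(Z\le z)=e^{-\mu_\alpha([0,z]^c)}$, $z\in(0,\infty)^d$. $\mathcal F(\alpha)$ is the Fréchet law with c.d.f. $e^{-x^{-\alpha}}$, $x>0$. In the integrals the integrand is taken to be $0$ when $y^j=0$ (the probability vanishes there). Distances: $\mathrm d_{\mathrm K}(X,Y)=\sup_{z\in(0,\infty)^d}|\mathbb{P}(X\le z)-\mathbb{P}(Y\le z)|$, and $\mathrm d_{\mathrm W}(X,Y)=\sup_h|\mathbb{E}h(X)-\mathbb{E}h(Y)|$, the supremum being over $h:\mathbb{R}_+^d\to\mathbb{R}$ with $|h(x)-h(y)|\le\|x-y\|_1$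 for all $x,y$. *)

theory Defs
  imports "HOL-Probability.Probability"
begin

definition is_norm :: "(real ^ 'n \<Rightarrow> real) \<Rightarrow> bool" where
  "is_norm nrm \<longleftrightarrow>
     (\<forall>x. nrm x = 0 \<longleftrightarrow> x = 0) \<and>
     (\<forall>c x. nrm (c *\<^sub>R x) = \<bar>c\<bar> * nrm x) \<and>
     (\<forall>x y. nrm (x + y) \<le> nrm x + nrm y)"

definition nonneg_orthant :: "(real ^ 'n) set" where
  "nonneg_orthant = {x. \<forall>j. 0 \<le> x $ j}"

(* The order < on real ^ 'n is not coordinate-wise strict, so positivity is spelled out. *)
definition pos_orthant :: "(real ^ 'n) set" where
  "pos_orthant = {x. \<forall>j. 0 < x $ j}"

definition E0 :: "(real ^ 'n) set" where
  "E0 = nonneg_orthant - {0}"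

definition sphere_plus :: "(real ^ 'n \<Rightarrow> real) \<Rightarrow> (real ^ 'n) set" where
  "sphere_plus nrm = {x \<in> nonneg_orthant. nrm x = 1}"

definition angular_measure :: "(real ^ 'n \<Rightarrow> real) \<Rightarrow> (real ^ 'n) measure \<Rightarrow> bool" where
  "angular_measure nrm \<nu> \<longleftrightarrow>
     finite_measure \<nu> \<and>
     sets \<nu> = sets (restrict_space borel (sphere_plus nrm)) \<and>
     (\<forall>j. (\<integral>u. u $ j \<partial>\<nu>) = 1)"

definition radial_measure :: "real \<Rightarrow> real measure" where
  "radial_measure \<alpha> =
     density (restrict_space lborel {0<..}) (\<lambda>r. ennreal (\<alpha> * r powr (- \<alpha> - 1)))"

(* The total mass is infinite; the complement in E0 of a box {0..z} with z in
   pos_orthant has finite mass, so that measure (rather than emeasure) may be used on it. *)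
definition exponent_measure :: "real \<Rightarrow> (real ^ 'n) measure \<Rightarrow> (real ^ 'n) measure" where
  "exponent_measure \<alpha> \<nu> =
     distr (radial_measure \<alpha> \<Otimes>\<^sub>M \<nu>) (restrict_space borel E0)
       (\<lambda>(r, u). \<chi> j. r * (u $ j) powr (1 / \<alpha>))"

(* Z, defined on the probability space M, has law MS(\<alpha>, \<nu>). The order \<le> and the
   intervals on real ^ 'n are coordinate-wise. *)
definition max_stable ::
    "real \<Rightarrow> (real ^ 'n) measure \<Rightarrow> 'a measure \<Rightarrow> ('a \<Rightarrow> real ^ 'n) \<Rightarrow> bool" where
  "max_stable \<alpha> \<nu> M Z \<longleftrightarrow>
     prob_space M \<and>
     Z \<in> M \<rightarrow>\<^sub>M restrict_space borel pos_orthant \<and>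
     (\<forall>z\<in>pos_orthant. measure M {\<omega> \<in> space M. Z \<omega> \<le> z}
        = exp (- measure (exponent_measure \<alpha> \<nu>) (E0 - {0..z})))"

(* The values of the c.d.f. on (0, \<infinity>) already force \<zeta> > 0 almost surely. *)
definition frechet :: "real \<Rightarrow> 'a measure \<Rightarrow> ('a \<Rightarrow> real) \<Rightarrow> bool" where
  "frechet \<alpha> M \<zeta> \<longleftrightarrow>
     prob_space M \<and> \<zeta> \<in> borel_measurable M \<and>
     (\<forall>x>0. measure M {\<omega> \<in> space M. \<zeta> \<omega> \<le> x} = exp (- (x powr (- \<alpha>))))"

definition kolmogorov_dist ::
    "'a measure \<Rightarrow> ('a \<Rightarrow> real ^ 'n) \<Rightarrow> 'b measure \<Rightarrow> ('b \<Rightarrow> real ^ 'n) \<Rightarrow> real" where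
  "kolmogorov_dist M X N Y =
     (SUP z\<in>pos_orthant.
        \<bar>measure M {\<omega> \<in> space M. X \<omega> \<le> z} - measure N {\<omega> \<in> space N. Y \<omega> \<le> z}\<bar>)"

definition lipschitz1 :: "(real ^ 'n \<Rightarrow> real) \<Rightarrow> bool" where
  "lipschitz1 h \<longleftrightarrow>
     (\<forall>x\<in>nonneg_orthant. \<forall>y\<in>nonneg_orthant. \<bar>h x - h y\<bar> \<le> (\<Sum>j\<in>UNIV. \<bar>x $ j - y $ j\<bar>))"

(* Meaningful for integrable X and Y with values in nonneg_orthant (everywhere, not just almost
   surely: h is unconstrained, possibly non-measurable, outside of it). The supremum is taken in
   ennreal because in real it would be unspecified if the set were unbounded. *)
definition wasserstein_dist ::
    "'a measure \<Rightarrow> ('a \<Rightarrow> real ^ 'n) \<Rightarrow> 'b measure \<Rightarrow> ('b \<Rightarrow> real ^ 'n) \<Rightarrow> ennreal" where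
  "wasserstein_dist M X N Y =
     (SUP h\<in>{h. lipschitz1 h}. ennreal \<bar>(\<integral>\<omega>. h (X \<omega>) \<partial>M) - (\<integral>\<omega>. h (Y \<omega>) \<partial>N)\<bar>)"

definition min_frechet_cdf :: "real \<Rightarrow> real \<Rightarrow> 'a measure \<Rightarrow> ('a \<Rightarrow> real) \<Rightarrow> real \<Rightarrow> real" where
  "min_frechet_cdf \<alpha>1 \<alpha>2 M \<zeta> t =
     measure M {\<omega> \<in> space M. min (\<zeta> \<omega> powr (\<alpha>2 / \<alpha>1)) (\<zeta> \<omega>) \<le> t}"

definition K_integrand ::
    "real \<Rightarrow> real \<Rightarrow> 'a measure \<Rightarrow> ('a \<Rightarrow> real) \<Rightarrow> 'n \<Rightarrow> real ^ 'n \<Rightarrow> real" where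
  "K_integrand \<alpha>1 \<alpha>2 M \<zeta> j y =
     (if y $ j = 0 then 0
      else \<bar>ln (y $ j)\<bar> * min_frechet_cdf \<alpha>1 \<alpha>2 M \<zeta> (y $ j))"

definition W_integrand ::
    "real \<Rightarrow> real \<Rightarrow> 'a measure \<Rightarrow> ('a \<Rightarrow> real) \<Rightarrow> 'n \<Rightarrow> real ^ 'n \<Rightarrow> real" where
  "W_integrand \<alpha>1 \<alpha>2 M \<zeta> j y =
     (if y $ j = 0 then 0
      else max 1 (y $ j) * \<bar>ln (y $ j)\<bar> * min_frechet_cdf \<alpha>1 \<alpha>2 M \<zeta> (y $ j))"

definition C_K ::
    "real \<Rightarrow> real \<Rightarrow> (real ^ 'n) measure \<Rightarrow> 'a measure \<Rightarrow> ('a \<Rightarrow> real) \<Rightarrow> real" where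
  "C_K \<alpha>1 \<alpha>2 \<nu> M \<zeta> =
     real CARD('n)
     + (\<Sum>j\<in>UNIV. \<integral>y. K_integrand \<alpha>1 \<alpha>2 M \<zeta> j y \<partial>exponent_measure \<alpha>1 \<nu>)"

definition C_W ::
    "real \<Rightarrow> real \<Rightarrow> (real ^ 'n) measure \<Rightarrow> 'a measure \<Rightarrow> ('a \<Rightarrow> real) \<Rightarrow> real" where
  "C_W \<alpha>1 \<alpha>2 \<nu> M \<zeta> =
     real CARD('n) * Gamma (1 - 1 / \<alpha>1)
     + (\<Sum>j\<in>UNIV. \<integral>y. W_integrand \<alpha>1 \<alpha>2 M \<zeta> j y \<partial>exponent_measure \<alpha>1 \<nu>)"

end

theory Submission
  imports Defs
begin

text \<open>
  Put \<open>\<beta> = \<alpha>2 / \<alpha>1 > 1\<close>; then \<open>(1/\<alpha>1 + 1/\<alpha>2) (\<alpha>2 - \<alpha>1) = \<beta> - 1/\<beta>\<close>. Integrating out the radius gives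
  \<open>\<mu>\<^sub>\<alpha>([0,z]\<^sup>c) = \<integral> max\<^sub>j u\<^sup>j (z\<^sup>j)\<^sup>-\<^sup>\<alpha> d\<nu>(u)\<close>, which is at least every \<open>(z\<^sup>j)\<^sup>-\<^sup>\<alpha>\<close> and is 1-Lipschitz for
  the \<open>\<ell>\<^sub>1\<close>-norm of the vector of these powers.

  Kolmogorov distance: the summand \<open>d\<close> of the constant alone suffices. If \<open>\<beta> - 1/\<beta> \<ge> 1\<close> there is
  nothing to prove. Otherwise \<open>\<beta> \<le> 2\<close>, and with \<open>x\<^sup>j = (z\<^sup>j)\<^sup>-\<^sup>\<alpha>\<^sup>1\<close> the difference of the distribution
  functions is at most \<open>\<Sum>\<^sub>j |x\<^sup>j - (x\<^sup>j)\<^sup>\<beta>| exp (- min (x\<^sup>j) ((x\<^sup>j)\<^sup>\<beta>))\<close>, each term of which is at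
  most \<open>\<beta> - 1/\<beta>\<close>.

  Wasserstein distance: \<open>Z\<^sub>2\<close> has the law of the coordinate-wise power \<open>Z\<^sub>1\<^sup>1\<^sup>/\<^sup>\<beta>\<close>, and
  \<open>|x - x\<^sup>1\<^sup>/\<^sup>\<beta>| \<le> (1 - 1/\<beta>) max(1,x) |ln x|\<close>. The margins of \<open>Z\<^sub>1\<close> are Frechet distributed, with
  density \<open>exp (- t\<^sup>-\<^sup>\<alpha>\<^sup>1)\<close> relative to the margin \<open>\<alpha>1 t\<^sup>-\<^sup>\<alpha>\<^sup>1\<^sup>-\<^sup>1 dt\<close> of the exponent measure, and
  \<open>exp (- t\<^sup>-\<^sup>\<alpha>\<^sup>1) = P(\<zeta> \<le> t) \<le> P(min (\<zeta>\<^sup>\<beta>) \<zeta> \<le> t)\<close>. So the integrals in the constant dominate the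
  expectations of \<open>max(1,x) |ln x|\<close>.
\<close>

subsection \<open>Radial and exponent measures\<close>

lemma borel_measurable_vec_nth [measurable]: "(\<lambda>x::real ^ 'n. x $ j) \<in> borel_measurable borel"
  by (intro borel_measurable_continuous_onI continuous_intros)

lemma borel_measurable_vec_lambda [measurable (raw)]:
  fixes f :: "'n::finite \<Rightarrow> 'a \<Rightarrow> real"
  assumes "\<And>j. f j \<in> borel_measurable M"
  shows "(\<lambda>x. \<chi> j. f j x) \<in> borel_measurable M"
proof (subst borel_measurable_euclidean_space, intro ballI)
  fix i :: "real ^ 'n" assume "i \<in> Basis"
  then obtain k where "i = axis k 1"
    by (auto simp: Basis_vec_def)
  then show "(\<lambda>x. (\<chi> j. f j x) \<bullet> i) \<in> borel_measurable M"
    using assms[of k] by (simp add: inner_axis)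
qed

lemma nonneg_orthant_borel [measurable]: "nonneg_orthant \<in> sets borel"
proof -
  have "nonneg_orthant = {x::real ^ 'n. \<forall>j\<in>UNIV. 0 \<le> x $ j}"
    by (simp add: nonneg_orthant_def)
  also have "\<dots> \<in> sets borel" by measurable
  finally show ?thesis .
qed

lemma pos_orthant_borel [measurable]: "pos_orthant \<in> sets borel"
proof -
  have "pos_orthant = {x::real ^ 'n. \<forall>j\<in>UNIV. 0 < x $ j}"
    by (simp add: pos_orthant_def)
  also have "\<dots> \<in> sets borel" by measurable
  finally show ?thesis .
qed

lemma E0_borel [measurable]: "E0 \<in> sets borel"
  by (simp add: E0_def sets.Diff)

lemma space_radial_measure [simp]: "space (radial_measure \<alpha>) = {0<..}"
  by (simp add: radial_measure_def space_restrict_space)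

lemma sets_radial_measure [measurable_cong]:
  "sets (radial_measure \<alpha>) = sets (restrict_space borel {0<..})"
  by (simp add: radial_measure_def sets_restrict_space)

lemma nn_integral_radial_measure:
  fixes f :: "real \<Rightarrow> ennreal"
  assumes [measurable]: "f \<in> borel_measurable borel"
  shows "(\<integral>\<^sup>+r. f r \<partial>radial_measure \<alpha>)
    = (\<integral>\<^sup>+r. ennreal (\<alpha> * r powr (- \<alpha> - 1)) * f r * indicator {0<..} r \<partial>lborel)"
  unfolding radial_measure_def
  by (subst nn_integral_density)
     (auto intro!: measurable_restrict_space1 simp: nn_integral_restrict_space)

text \<open>The radial mass near 0 is infinite for positive alpha; sigma-finiteness is what
  Tonelli's theorem for \<open>exponent_measure\<close> relies on.\<close>

lemma sigma_finite_radial_measure: "sigma_finite_measure (radial_measure \<alpha>)"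
proof -
  interpret sigma_finite_measure "restrict_space lborel {0::real<..}"
    by (intro sigma_finite_measure_restrict_space sigma_finite_lborel) simp
  show ?thesis
    unfolding radial_measure_def
    by (subst sigma_finite_iff_density_finite) (auto intro!: measurable_restrict_space1)
qed

lemma emeasure_radial_measure_greaterThan:
  assumes "0 < \<alpha>" "0 < c"
  shows "emeasure (radial_measure \<alpha>) {c<..} = ennreal (c powr - \<alpha>)"
proof -
  have "{c<..} \<in> sets (radial_measure \<alpha>)"
    using assms unfolding sets_radial_measure sets_restrict_space
    by (intro image_eqI[of _ _ "{c<..}"]) auto
  then have "emeasure (radial_measure \<alpha>) {c<..} = (\<integral>\<^sup>+r. indicator {c<..} r \<partial>radial_measure \<alpha>)"
    by simp
  also have "\<dots> = (\<integral>\<^sup>+r. ennreal (\<alpha> * r powr (- \<alpha> - 1)) * indicator {c<..} r * indicator {0<..} r \<partial>lborel)"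
    by (subst nn_integral_radial_measure) auto
  \<comment> \<open>The endpoint c is a null set. Closing the half-line fits the fundamental
    theorem, with an antiderivative - r^(-alpha) that vanishes at infinity.\<close>
  also have "\<dots> = (\<integral>\<^sup>+r. ennreal (\<alpha> * r powr (- \<alpha> - 1)) * indicator {c..} r \<partial>lborel)"
    using assms AE_lborel_singleton[of c]
    by (intro nn_integral_cong_AE) (auto elim!: eventually_mono split: split_indicator)
  also have "\<dots> = ennreal (0 - (- (c powr - \<alpha>)))"
  proof (rule nn_integral_FTC_atLeast)
    fix x assume "c \<le> x"
    with assms show "DERIV (\<lambda>r. - (r powr - \<alpha>)) x :> \<alpha> * x powr (- \<alpha> - 1)"
      by (auto intro!: derivative_eq_intros)
    show "0 \<le> \<alpha> * x powr (- \<alpha> - 1)"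
      using assms by simp
  next
    show "((\<lambda>r. - (r powr - \<alpha>)) \<longlongrightarrow> 0) at_top"
      using assms tendsto_minus[OF tendsto_neg_powr[of "- \<alpha>" "\<lambda>x. x" at_top]]
      by (simp add: filterlim_ident)
  qed simp
  finally show ?thesis by simp
qed

text \<open>The substitution r -> c r gives a factor c, and the density is homogeneous of degree -
  alpha - 1. With c = (u^j)^(1/alpha) the scale factor is u^j, so angular components come out
  linearly.\<close>

lemma nn_integral_radial_measure_scale:
  fixes f :: "real \<Rightarrow> ennreal"
  assumes [measurable]: "f \<in> borel_measurable borel" and "0 < \<alpha>" "0 < c"
  shows "(\<integral>\<^sup>+r. f (r * c) \<partial>radial_measure \<alpha>) = ennreal (c powr \<alpha>) * (\<integral>\<^sup>+r. f r \<partial>radial_measure \<alpha>)"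
proof -
  have "(\<integral>\<^sup>+r. f r \<partial>radial_measure \<alpha>)
      = ennreal c * (\<integral>\<^sup>+r. ennreal (\<alpha> * (c * r) powr (- \<alpha> - 1)) * f (c * r) * indicator {0<..} (c * r) \<partial>lborel)"
    using assms by (subst nn_integral_radial_measure, simp, subst nn_integral_real_affine[of _ c 0]) auto
  also have "\<dots> = ennreal c * (\<integral>\<^sup>+r. ennreal (c powr (- \<alpha> - 1)) * (ennreal (\<alpha> * r powr (- \<alpha> - 1)) * f (r * c) * indicator {0<..} r) \<partial>lborel)"
  proof (rule arg_cong2[where f="(*)", OF refl], rule nn_integral_cong)
    fix r
    show "ennreal (\<alpha> * (c * r) powr (- \<alpha> - 1)) * f (c * r) * indicator {0<..} (c * r)
      = ennreal (c powr (- \<alpha> - 1)) * (ennreal (\<alpha> * r powr (- \<alpha> - 1)) * f (r * c) * indicator {0<..} r)"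
    proof (cases "0 < r")
      case True
      then have "ennreal (\<alpha> * (c * r) powr (- \<alpha> - 1)) = ennreal (c powr (- \<alpha> - 1)) * ennreal (\<alpha> * r powr (- \<alpha> - 1))"
        using assms by (simp add: powr_mult ennreal_mult[symmetric] mult_ac)
      with True assms show ?thesis by (simp add: mult_ac)
    qed (use assms in \<open>simp add: zero_less_mult_iff\<close>)
  qed
  also have "\<dots> = ennreal c * ennreal (c powr (- \<alpha> - 1)) * (\<integral>\<^sup>+r. f (r * c) \<partial>radial_measure \<alpha>)"
    by (subst nn_integral_cmult) (auto simp: nn_integral_radial_measure mult_ac)
  also have "ennreal c * ennreal (c powr (- \<alpha> - 1)) = ennreal (c powr - \<alpha>)"
    using assms by (simp add: ennreal_mult[symmetric] powr_mult_base)
  finally have "ennreal (c powr \<alpha>) * (\<integral>\<^sup>+r. f r \<partial>radial_measure \<alpha>)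
      = ennreal (c powr \<alpha>) * ennreal (c powr - \<alpha>) * (\<integral>\<^sup>+r. f (r * c) \<partial>radial_measure \<alpha>)"
    by (simp add: mult_ac)
  also have "ennreal (c powr \<alpha>) * ennreal (c powr - \<alpha>) = 1"
    using assms by (simp add: ennreal_mult[symmetric] powr_add[symmetric])
  finally show ?thesis by simp
qed

section \<open>Integration against the angular and the exponent measure\<close>

lemma angular_measure_space:
  assumes "angular_measure nrm \<nu>"
  shows "space \<nu> = sphere_plus nrm"
  using assms sets_eq_imp_space_eq[of \<nu> "restrict_space borel (sphere_plus nrm)"]
  by (simp add: angular_measure_def space_restrict_space)

lemma angular_measure_measurable:
  assumes "angular_measure nrm \<nu>" "f \<in> borel_measurable borel"
  shows "f \<in> borel_measurable \<nu>"
proof -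
  have [measurable_cong]: "sets \<nu> = sets (restrict_space borel (sphere_plus nrm))"
    using assms by (simp add: angular_measure_def)
  note [measurable] = measurable_restrict_space1[OF assms(2), of "sphere_plus nrm"]
  show ?thesis by measurable
qed

lemma angular_measure_nonneg:
  assumes "angular_measure nrm \<nu>" "u \<in> space \<nu>"
  shows "0 \<le> u $ j"
  using assms by (auto simp: angular_measure_space sphere_plus_def nonneg_orthant_def)

lemma angular_measure_nonzero:
  assumes "is_norm nrm" "angular_measure nrm \<nu>" "u \<in> space \<nu>"
  shows "u \<noteq> 0"
proof -
  have "nrm u = 1" "nrm 0 = 0"
    using assms by (simp_all add: angular_measure_space sphere_plus_def is_norm_def)
  then show ?thesis by auto
qed

lemma angular_measure_pos_component:
  assumes "is_norm nrm" "angular_measure nrm \<nu>" "u \<in> space \<nu>"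
  obtains j where "0 < u $ j"
  using angular_measure_nonzero[OF assms] angular_measure_nonneg[OF assms(2,3)]
  by (metis order_le_less vec_eq_iff zero_index)

text \<open>The Bochner integral of a non-integrable function is 0, so the normalisation to 1 forces
  integrability.\<close>

lemma angular_measure_integrable_nth:
  assumes "angular_measure nrm \<nu>"
  shows "integrable \<nu> (\<lambda>u. u $ j)"
  using assms not_integrable_integral_eq[of \<nu> "\<lambda>u. u $ j"]
  by (auto simp: angular_measure_def)

lemma exponent_map_measurable:
  fixes \<nu> :: "(real ^ 'n) measure"
  assumes "is_norm nrm" "angular_measure nrm \<nu>"
  shows "(\<lambda>(r, u). \<chi> j. r * (u $ j) powr (1 / \<alpha>))
    \<in> radial_measure \<alpha>' \<Otimes>\<^sub>M \<nu> \<rightarrow>\<^sub>M restrict_space borel (E0 :: (real ^ 'n) set)"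
proof (rule measurable_restrict_space2)
  have [measurable]: "(\<lambda>u. u $ j) \<in> borel_measurable \<nu>" for j
    by (rule angular_measure_measurable[OF assms(2) borel_measurable_vec_nth])
  have [measurable]: "(\<lambda>r. r) \<in> borel_measurable (radial_measure \<alpha>')"
    using measurable_restrict_space1[of "\<lambda>r. r" borel borel "{0<..}"]
    by (simp add: measurable_cong_sets[OF sets_radial_measure refl])
  show "(\<lambda>(r, u). \<chi> j. r * (u $ j) powr (1 / \<alpha>)) \<in> borel_measurable (radial_measure \<alpha>' \<Otimes>\<^sub>M \<nu>)"
    by measurable
  show "(\<lambda>(r, u). \<chi> j. r * (u $ j) powr (1 / \<alpha>))
    \<in> space (radial_measure \<alpha>' \<Otimes>\<^sub>M \<nu>) \<rightarrow> (E0 :: (real ^ 'n) set)"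
  proof (clarsimp simp: space_pair_measure)
    fix r :: real and u assume "0 < r" and u: "u \<in> space \<nu>"
    \<comment> \<open>Points of norm 1 are nonzero, so the ray through one keeps a positive
      component and stays in \<open>E0\<close>.\<close>
    obtain j where "0 < u $ j"
      by (rule angular_measure_pos_component[OF assms u])
    with \<open>0 < r\<close> show "(\<chi> j. r * (u $ j) powr (1 / \<alpha>)) \<in> (E0 :: (real ^ 'n) set)"
      by (auto simp: E0_def nonneg_orthant_def vec_eq_iff intro!: exI[of _ j])
  qed
qed

lemma nn_integral_exponent_measure:
  fixes \<nu> :: "(real ^ 'n) measure" and f :: "real ^ 'n \<Rightarrow> ennreal"
  assumes "is_norm nrm" "angular_measure nrm \<nu>"
    and [measurable]: "f \<in> borel_measurable (restrict_space borel E0)"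
  shows "(\<integral>\<^sup>+y. f y \<partial>exponent_measure \<alpha> \<nu>)
    = (\<integral>\<^sup>+u. (\<integral>\<^sup>+r. f (\<chi> j. r * (u $ j) powr (1 / \<alpha>)) \<partial>radial_measure \<alpha>) \<partial>\<nu>)"
proof -
  interpret R: sigma_finite_measure "radial_measure \<alpha>"
    by (rule sigma_finite_radial_measure)
  interpret N: finite_measure \<nu>
    using assms by (simp add: angular_measure_def)
  interpret pair_sigma_finite "radial_measure \<alpha>" \<nu> ..
  note m = exponent_map_measurable[OF assms(1,2), of \<alpha> \<alpha>]
  have "(\<integral>\<^sup>+y. f y \<partial>exponent_measure \<alpha> \<nu>)
      = (\<integral>\<^sup>+x. f ((\<lambda>(r, u). \<chi> j. r * (u $ j) powr (1 / \<alpha>)) x) \<partial>(radial_measure \<alpha> \<Otimes>\<^sub>M \<nu>))"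
    unfolding exponent_measure_def by (subst nn_integral_distr[OF m]) (auto simp: assms(3))
  also have "\<dots> = (\<integral>\<^sup>+u. (\<integral>\<^sup>+r. f (\<chi> j. r * (u $ j) powr (1 / \<alpha>)) \<partial>radial_measure \<alpha>) \<partial>\<nu>)"
    using nn_integral_snd[OF measurable_compose[OF m assms(3)]] by simp
  finally show ?thesis .
qed

text \<open>Away from 0 every margin of the exponent measure is the radial measure: scaling extracts
  the factor u^j, whose angular integral is 1. The condition f 0 = 0 removes the rays with u^j = 0,
  on which the radial mass is infinite.\<close>

lemma nn_integral_exponent_measure_nth:
  fixes \<nu> :: "(real ^ 'n) measure" and f :: "real \<Rightarrow> ennreal"
  assumes "is_norm nrm" "angular_measure nrm \<nu>" "0 < \<alpha>"
    and [measurable]: "f \<in> borel_measurable borel" and "f 0 = 0"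
  shows "(\<integral>\<^sup>+y. f (y $ j) \<partial>exponent_measure \<alpha> \<nu>) = (\<integral>\<^sup>+t. f t \<partial>radial_measure \<alpha>)"
proof -
  have [measurable]: "(\<lambda>u. u $ j) \<in> borel_measurable \<nu>"
    by (rule angular_measure_measurable[OF assms(2) borel_measurable_vec_nth])
  have "(\<integral>\<^sup>+y. f (y $ j) \<partial>exponent_measure \<alpha> \<nu>)
      = (\<integral>\<^sup>+u. (\<integral>\<^sup>+r. f (r * (u $ j) powr (1 / \<alpha>)) \<partial>radial_measure \<alpha>) \<partial>\<nu>)"
    by (subst nn_integral_exponent_measure[OF assms(1,2)]) (auto intro!: measurable_restrict_space1)
  also have "\<dots> = (\<integral>\<^sup>+u. ennreal (u $ j) * (\<integral>\<^sup>+t. f t \<partial>radial_measure \<alpha>) \<partial>\<nu>)"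
  proof (rule nn_integral_cong)
    fix u assume u: "u \<in> space \<nu>"
    show "(\<integral>\<^sup>+r. f (r * (u $ j) powr (1 / \<alpha>)) \<partial>radial_measure \<alpha>)
        = ennreal (u $ j) * (\<integral>\<^sup>+t. f t \<partial>radial_measure \<alpha>)"
    proof (cases "u $ j = 0")
      case True
      then show ?thesis using assms by simp
    next
      case False
      with angular_measure_nonneg[OF assms(2) u, of j] assms show ?thesis
        by (subst nn_integral_radial_measure_scale) (auto simp: powr_powr)
    qed
  qed
  also have "\<dots> = (\<integral>\<^sup>+u. ennreal (u $ j) \<partial>\<nu>) * (\<integral>\<^sup>+t. f t \<partial>radial_measure \<alpha>)"
    by (subst nn_integral_multc) auto
  also have "(\<integral>\<^sup>+u. ennreal (u $ j) \<partial>\<nu>) = 1"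
    using angular_measure_integrable_nth[OF assms(2)] assms(2) angular_measure_nonneg[OF assms(2)]
    by (subst nn_integral_eq_integral) (auto simp: angular_measure_def intro!: AE_I2)
  finally show ?thesis by simp
qed

section \<open>Angular integrals of weighted maxima and the distribution function of a max-stable
  vector\<close>

text \<open>In extreme value theory this is the stable tail dependence function of
  \<open>\<nu>\<close> at w.\<close>

definition max_integral :: "(real ^ 'n) measure \<Rightarrow> ('n \<Rightarrow> real) \<Rightarrow> real" where
  "max_integral \<nu> w = (\<integral>u. Max (range (\<lambda>j. u $ j * w j)) \<partial>\<nu>)"

lemma integrable_Max_angular_measure:
  fixes \<nu> :: "(real ^ 'n) measure"
  assumes "angular_measure nrm \<nu>" "\<And>j. 0 \<le> w j"
  shows "integrable \<nu> (\<lambda>u. Max (range (\<lambda>j. u $ j * w j)))"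
proof (rule Bochner_Integration.integrable_bound)
  show "integrable \<nu> (\<lambda>u. \<Sum>j\<in>UNIV. u $ j * w j)"
    by (intro Bochner_Integration.integrable_sum integrable_mult_left
        angular_measure_integrable_nth[OF assms(1)])
  show "(\<lambda>u. Max (range (\<lambda>j. u $ j * w j))) \<in> borel_measurable \<nu>"
    by (rule angular_measure_measurable[OF assms(1)]) simp
  show "AE u in \<nu>. norm (Max (range (\<lambda>j. u $ j * w j))) \<le> norm (\<Sum>j\<in>UNIV. u $ j * w j)"
  proof (rule AE_I2)
    fix u assume "u \<in> space \<nu>"
    note nn = mult_nonneg_nonneg[OF angular_measure_nonneg[OF assms(1) this] assms(2)]
    have "0 \<le> Max (range (\<lambda>j. u $ j * w j))"
      using nn by (subst Max_ge_iff) auto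
    moreover have "Max (range (\<lambda>j. u $ j * w j)) \<le> (\<Sum>j\<in>UNIV. u $ j * w j)"
      using nn by (auto intro!: member_le_sum)
    ultimately show "norm (Max (range (\<lambda>j. u $ j * w j))) \<le> norm (\<Sum>j\<in>UNIV. u $ j * w j)"
      by (simp only: real_norm_def abs_of_nonneg)
  qed
qed

text \<open>The maximum dominates its entry at j, and u^j has angular integral 1.\<close>

lemma max_integral_ge:
  fixes \<nu> :: "(real ^ 'n) measure"
  assumes "angular_measure nrm \<nu>" "\<And>j. 0 \<le> w j"
  shows "w j \<le> max_integral \<nu> w"
proof -
  have "w j = (\<integral>u. u $ j * w j \<partial>\<nu>)"
    using assms(1) by (simp add: angular_measure_def)
  also have "\<dots> \<le> max_integral \<nu> w"
    unfolding max_integral_def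
    by (intro integral_mono integrable_Max_angular_measure[OF assms] integrable_mult_left
        angular_measure_integrable_nth[OF assms(1)]) simp
  finally show ?thesis .
qed

text \<open>Pointwise, u^j w_j exceeds u^j w'_j by at most u^j times the positive part of w_j -
  w'_j, and the u^j have unit integrals. With w' = 0 this one-sided form also serves as an upper
  bound of \<open>max_integral\<close>.\<close>

lemma max_integral_diff_le:
  fixes \<nu> :: "(real ^ 'n) measure"
  assumes "angular_measure nrm \<nu>" "\<And>j. 0 \<le> w j" "\<And>j. 0 \<le> w' j"
  shows "max_integral \<nu> w - max_integral \<nu> w' \<le> (\<Sum>j\<in>UNIV. max 0 (w j - w' j))"
proof -
  have "max_integral \<nu> w \<le> (\<integral>u. Max (range (\<lambda>j. u $ j * w' j)) + (\<Sum>j\<in>UNIV. u $ j * max 0 (w j - w' j)) \<partial>\<nu>)"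
    unfolding max_integral_def
  proof (rule integral_mono)
    fix u assume u: "u \<in> space \<nu>"
    have "u $ j * w j \<le> Max (range (\<lambda>j. u $ j * w' j)) + (\<Sum>j\<in>UNIV. u $ j * max 0 (w j - w' j))" for j
    proof -
      have "u $ j * w j \<le> u $ j * w' j + u $ j * max 0 (w j - w' j)"
        using angular_measure_nonneg[OF assms(1) u, of j]
        by (simp add: distrib_left[symmetric] mult_left_mono)
      also have "\<dots> \<le> Max (range (\<lambda>j. u $ j * w' j)) + (\<Sum>j\<in>UNIV. u $ j * max 0 (w j - w' j))"
        using angular_measure_nonneg[OF assms(1) u]
        by (intro add_mono member_le_sum[where i=j and f="\<lambda>j. u $ j * max 0 (w j - w' j)"]) auto
      finally show ?thesis .
    qed
    then show "Max (range (\<lambda>j. u $ j * w j)) \<le> Max (range (\<lambda>j. u $ j * w' j)) + (\<Sum>j\<in>UNIV. u $ j * max 0 (w j - w' j))"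
      by auto
  qed (auto intro!: integrable_Max_angular_measure[OF assms(1)] assms
      Bochner_Integration.integrable_sum angular_measure_integrable_nth[OF assms(1)])
  also have "\<dots> = max_integral \<nu> w' + (\<Sum>j\<in>UNIV. (\<integral>u. u $ j \<partial>\<nu>) * max 0 (w j - w' j))"
    unfolding max_integral_def
    by (subst Bochner_Integration.integral_add)
       (auto intro!: integrable_Max_angular_measure[OF assms(1)] assms
         Bochner_Integration.integrable_sum angular_measure_integrable_nth[OF assms(1)]
         simp: Bochner_Integration.integral_sum angular_measure_integrable_nth[OF assms(1)])
  also have "\<dots> = max_integral \<nu> w' + (\<Sum>j\<in>UNIV. max 0 (w j - w' j))"
    using assms(1) by (simp add: angular_measure_def)
  finally show ?thesis by simp
qed

lemma max_integral_abs_diff_le: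
  fixes \<nu> :: "(real ^ 'n) measure"
  assumes "angular_measure nrm \<nu>" "\<And>j. 0 \<le> w j" "\<And>j. 0 \<le> w' j"
  shows "\<bar>max_integral \<nu> w - max_integral \<nu> w'\<bar> \<le> (\<Sum>j\<in>UNIV. \<bar>w j - w' j\<bar>)"
proof -
  have "(\<Sum>j\<in>UNIV. max 0 (w j - w' j)) \<le> (\<Sum>j\<in>UNIV. \<bar>w j - w' j\<bar>)"
    "(\<Sum>j\<in>UNIV. max 0 (w' j - w j)) \<le> (\<Sum>j\<in>UNIV. \<bar>w j - w' j\<bar>)"
    by (auto intro!: sum_mono)
  moreover have "max_integral \<nu> w - max_integral \<nu> w' \<le> (\<Sum>j\<in>UNIV. max 0 (w j - w' j))"
    "max_integral \<nu> w' - max_integral \<nu> w \<le> (\<Sum>j\<in>UNIV. max 0 (w' j - w j))"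
    using max_integral_diff_le[of nrm \<nu> w w'] max_integral_diff_le[of nrm \<nu> w' w] assms by auto
  ultimately show ?thesis by linarith
qed

lemma powr_less_powr_iff:
  fixes x y a :: real
  assumes "0 < a" "0 \<le> x" "0 \<le> y"
  shows "x powr a < y powr a \<longleftrightarrow> x < y"
  using powr_less_mono2[of a x y] powr_mono2[of a y x] assms by force

text \<open>On the ray through u the box is left exactly at the radii above m^(-1/alpha), where m is
  the maximum of u^j (z^j)^(-alpha). The radial mass of these radii is m.\<close>

lemma measure_exponent_measure_box:
  fixes \<nu> :: "(real ^ 'n) measure"
  assumes "is_norm nrm" "angular_measure nrm \<nu>" "0 < \<alpha>" "z \<in> pos_orthant"
  shows "measure (exponent_measure \<alpha> \<nu>) (E0 - {0..z}) = max_integral \<nu> (\<lambda>j. (z $ j) powr - \<alpha>)"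
proof -
  have z: "0 < z $ j" for j
    using assms by (simp add: pos_orthant_def)
  have A: "E0 - {0..z} \<in> sets (exponent_measure \<alpha> \<nu>)"
    by (auto simp: exponent_measure_def sets_restrict_space intro!: image_eqI[of _ _ "- {0..z}"])
  have "emeasure (exponent_measure \<alpha> \<nu>) (E0 - {0..z}) = (\<integral>\<^sup>+y. indicator (E0 - {0..z}) y \<partial>exponent_measure \<alpha> \<nu>)"
    using A by simp
  also have "\<dots> = (\<integral>\<^sup>+u. (\<integral>\<^sup>+r. indicator (E0 - {0..z}) (\<chi> j. r * (u $ j) powr (1 / \<alpha>)) \<partial>radial_measure \<alpha>) \<partial>\<nu>)"
    using A by (intro nn_integral_exponent_measure[OF assms(1,2)])
      (simp add: exponent_measure_def)
  also have "\<dots> = (\<integral>\<^sup>+u. ennreal (Max (range (\<lambda>j. u $ j * (z $ j) powr - \<alpha>))) \<partial>\<nu>)"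
  proof (rule nn_integral_cong)
    fix u assume u: "u \<in> space \<nu>"
    note nn = angular_measure_nonneg[OF assms(2) u]
    define m where "m = Max (range (\<lambda>j. u $ j * (z $ j) powr - \<alpha>))"
    obtain k where k: "0 < u $ k"
      by (rule angular_measure_pos_component[OF assms(1,2) u])
    have "0 < u $ k * (z $ k) powr - \<alpha>"
      using k z[of k] by simp
    then have m: "0 < m"
      unfolding m_def by (subst Max_gr_iff) auto
    have iff: "z $ j < r * (u $ j) powr (1 / \<alpha>) \<longleftrightarrow> r powr - \<alpha> < u $ j * (z $ j) powr - \<alpha>"
      if r: "0 < r" for r j
    proof -
      have "z $ j < r * (u $ j) powr (1 / \<alpha>) \<longleftrightarrow> (z $ j) powr \<alpha> < (r * (u $ j) powr (1 / \<alpha>)) powr \<alpha>"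
        using z[of j] r nn[of j] assms(3) by (subst powr_less_powr_iff) auto
      also have "\<dots> \<longleftrightarrow> (z $ j) powr \<alpha> < r powr \<alpha> * u $ j"
        using r nn[of j] assms(3) by (simp add: powr_mult powr_powr)
      also have "\<dots> \<longleftrightarrow> r powr - \<alpha> < u $ j * (z $ j) powr - \<alpha>"
        using r z[of j] by (simp add: powr_minus field_simps)
      finally show ?thesis .
    qed
    have "(\<chi> j. r * (u $ j) powr (1 / \<alpha>)) \<in> E0 - {0..z} \<longleftrightarrow> m powr (- 1 / \<alpha>) < r"
      if r: "0 < r" for r
    proof -
      have "(\<chi> j. r * (u $ j) powr (1 / \<alpha>)) \<in> E0"
        using k r by (auto simp: E0_def nonneg_orthant_def vec_eq_iff intro!: exI[of _ k])
      then have "(\<chi> j. r * (u $ j) powr (1 / \<alpha>)) \<in> E0 - {0..z} \<longleftrightarrow> (\<exists>j. z $ j < r * (u $ j) powr (1 / \<alpha>))"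
        using r by (auto simp: less_eq_vec_def not_le)
      also have "\<dots> \<longleftrightarrow> r powr - \<alpha> < m"
        unfolding m_def iff[OF r] by (subst Max_gr_iff) auto
      also have "\<dots> \<longleftrightarrow> (r powr - \<alpha>) powr (1 / \<alpha>) < m powr (1 / \<alpha>)"
        using assms(3) m by (subst powr_less_powr_iff) auto
      also have "\<dots> \<longleftrightarrow> m powr (- 1 / \<alpha>) < r"
      proof -
        have "(r powr - \<alpha>) powr (1 / \<alpha>) = inverse r"
          using r assms(3) by (subst powr_powr) (simp add: powr_minus)
        moreover have "inverse r < m powr (1 / \<alpha>) \<longleftrightarrow> m powr (- 1 / \<alpha>) < r"
          using r m by (simp add: powr_minus field_simps)
        ultimately show ?thesis by (simp only:)
      qed
      finally show ?thesis .
    qed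
    then have "(\<integral>\<^sup>+r. indicator (E0 - {0..z}) (\<chi> j. r * (u $ j) powr (1 / \<alpha>)) \<partial>radial_measure \<alpha>)
        = (\<integral>\<^sup>+r. indicator {m powr (- 1 / \<alpha>)<..} r \<partial>radial_measure \<alpha>)"
      by (intro nn_integral_cong) (auto split: split_indicator)
    also have "\<dots> = emeasure (radial_measure \<alpha>) {m powr (- 1 / \<alpha>)<..}"
      using m by (intro nn_integral_indicator)
        (auto simp: sets_radial_measure sets_restrict_space intro!: image_eqI[of _ _ "{m powr (- 1 / \<alpha>)<..}"]
          intro: le_less_trans[OF powr_ge_zero])
    also have "\<dots> = ennreal m"
      using assms(3) m by (subst emeasure_radial_measure_greaterThan) (auto simp: powr_powr)
    finally show "(\<integral>\<^sup>+r. indicator (E0 - {0..z}) (\<chi> j. r * (u $ j) powr (1 / \<alpha>)) \<partial>radial_measure \<alpha>)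
        = ennreal (Max (range (\<lambda>j. u $ j * (z $ j) powr - \<alpha>)))"
      by (simp add: m_def)
  qed
  also have "\<dots> = ennreal (max_integral \<nu> (\<lambda>j. (z $ j) powr - \<alpha>))"
    unfolding max_integral_def
    using angular_measure_nonneg[OF assms(2)]
    by (intro nn_integral_eq_integral integrable_Max_angular_measure[OF assms(2)] AE_I2)
       (auto simp: Max_ge_iff)
  \<comment> \<open>Passing from \<open>emeasure\<close> to \<open>measure\<close> needs
    \<open>max_integral\<close> to be nonnegative, which any coordinate shows;
    \<open>undefined\<close> names one.\<close>
  finally show ?thesis
    using max_integral_ge[OF assms(2), of "\<lambda>j. (z $ j) powr - \<alpha>" undefined]
    by (simp add: measure_def powr_ge_zero order_trans[OF powr_ge_zero])
qed

lemma max_stable_cdf: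
  fixes \<nu> :: "(real ^ 'n) measure"
  assumes "is_norm nrm" "angular_measure nrm \<nu>" "0 < \<alpha>" "max_stable \<alpha> \<nu> M Z" "z \<in> pos_orthant"
  shows "measure M {\<omega> \<in> space M. Z \<omega> \<le> z} = exp (- max_integral \<nu> (\<lambda>j. (z $ j) powr - \<alpha>))"
  using assms measure_exponent_measure_box[OF assms(1,2,3,5)] by (simp add: max_stable_def)

subsection \<open>The Kolmogorov distance\<close>

text \<open>Factor out the larger exponential and use 1 - exp (- s) <= s. The factor exp (- min a b)
  is kept because it has to absorb the growth of x^beta later.\<close>

lemma abs_exp_minus_diff_le:
  fixes a b :: real
  shows "\<bar>exp (- a) - exp (- b)\<bar> \<le> exp (- min a b) * \<bar>a - b\<bar>"
proof -
  have *: "exp (- a) - exp (- b) \<le> exp (- a) * (b - a)" "0 \<le> exp (- a) - exp (- b)"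
    if "a \<le> b" for a b :: real
  proof -
    have "exp (- a) - exp (- b) = exp (- a) * (1 - exp (- (b - a)))"
      by (simp add: exp_diff exp_minus field_simps)
    also have "\<dots> \<le> exp (- a) * (b - a)"
      using exp_ge_add_one_self[of "- (b - a)"] by (intro mult_left_mono) (linarith, simp)
    finally show "exp (- a) - exp (- b) \<le> exp (- a) * (b - a)" .
  qed (use that in simp)
  show ?thesis
    using *[of a b] *[of b a] by (cases "a \<le> b") (auto simp: min_def)
qed

text \<open>This is 1 + s <= exp s at s = a ln x. The sign of a is left free: exponents of both
  signs are used below.\<close>

lemma one_minus_powr_le:
  fixes x a :: real
  assumes "0 < x"
  shows "1 - x powr a \<le> - (a * ln x)"
proof -
  have "x powr a = exp (a * ln x)"
    using assms by (simp add: powr_def)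
  with exp_ge_add_one_self[of "a * ln x"] show ?thesis by linarith
qed

text \<open>The constant 3/2 is what the case x > 1 of \<open>powr_diff_mult_exp_le\<close> can
  afford, since 1 + 1/beta >= 3/2 for beta <= 2.\<close>

lemma power2_mult_ln_le:
  fixes x :: real
  assumes "1 \<le> x"
  shows "x ^ 2 * ln x \<le> 3 / 2 * exp x"
proof -
  have "ln x \<le> x / 2"
  proof -
    \<comment> \<open>The shift by ln 2 makes the constants cancel: ln (x/2) <= x/2 - 1 and ln 2 <=
      1.\<close>
    have "ln x = ln (x / 2) + ln 2"
      using assms by (simp add: ln_div)
    also have "\<dots> \<le> (x / 2 - 1) + (2 - 1)"
      using assms by (intro add_mono ln_le_minus_one) auto
    finally show ?thesis by simp
  qed
  then have "x ^ 2 * ln x \<le> x ^ 2 * (x / 2)"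
    by (intro mult_left_mono) auto
  \<comment> \<open>As x^3 exp (- x) is largest at x = 3, the inequality s <= exp (s - 1) is applied
    at s = x/3, where it is sharp for x = 3.\<close>
  also have "\<dots> = 27 / 2 * (x / 3) ^ 3"
    by (simp add: power2_eq_square power3_eq_cube)
  also have "\<dots> \<le> 27 / 2 * exp (x / 3 - 1) ^ 3"
    using exp_ge_add_one_self[of "x / 3 - 1"] assms by (intro mult_left_mono power_mono) auto
  also have "exp (x / 3 - 1) ^ 3 = exp (x - 3)"
    by (simp add: exp_of_nat_mult[symmetric] right_diff_distrib)
  \<comment> \<open>What remains is exp 3 >= 9. The bound exp (1/2) >= 3/2 suffices, since (3/2)^6 =
    729/64 > 9.\<close>
  also have "exp (x - 3) = exp x / exp (1 / 2) ^ 6"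
    by (simp add: exp_diff exp_of_nat_mult[symmetric])
  also have "27 / 2 * (exp x / exp (1 / 2) ^ 6) \<le> 27 / 2 * (exp x / (3 / 2) ^ 6)"
    using exp_ge_add_one_self[of "1 / 2"]
    by (intro mult_left_mono divide_left_mono power_mono mult_pos_pos) auto
  also have "\<dots> \<le> 3 / 2 * exp x"
    by (simp add: field_simps)
  finally show ?thesis .
qed

text \<open>For x <= 1 the exponential is at most 1 and x - x^beta <= (beta - 1) x |ln x| <= beta -
  1. For x > 1 the exponential is exp (- x), which absorbs x^beta ln x <= x^2 ln x; the target
  factors as (beta - 1) (1 + 1/beta).\<close>

lemma powr_diff_mult_exp_le:
  fixes x \<beta> :: real
  assumes "0 < x" "1 < \<beta>" "\<beta> \<le> 2"
  shows "\<bar>x - x powr \<beta>\<bar> * exp (- min x (x powr \<beta>)) \<le> \<beta> - 1 / \<beta>"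
proof (cases "x \<le> 1")
  case True
  have "x - x powr \<beta> = x * (1 - x powr (\<beta> - 1))"
    using assms by (simp add: powr_diff field_simps)
  moreover have "x powr (\<beta> - 1) \<le> 1"
    using True assms by (intro powr_le1) auto
  moreover have "x * (1 - x powr (\<beta> - 1)) \<le> \<beta> - 1"
  proof -
    have "x * (1 - x powr (\<beta> - 1)) \<le> x * (- ((\<beta> - 1) * ln x))"
      using assms by (intro mult_left_mono one_minus_powr_le) auto
    also have "\<dots> = (\<beta> - 1) * (x * - ln x)"
      by simp
    also have "x * - ln x \<le> x * (inverse x - 1)"
      using assms ln_le_minus_one[of "inverse x"] by (intro mult_left_mono) (auto simp: ln_inverse)
    also have "\<dots> \<le> 1"
      using assms by (simp add: right_diff_distrib)
    finally show ?thesis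
      using assms by simp
  qed
  ultimately have "\<bar>x - x powr \<beta>\<bar> \<le> \<beta> - 1"
    using assms by simp
  moreover have "exp (- min x (x powr \<beta>)) \<le> 1"
    using assms by (auto simp: min_def)
  ultimately have "\<bar>x - x powr \<beta>\<bar> * exp (- min x (x powr \<beta>)) \<le> (\<beta> - 1) * 1"
    by (intro mult_mono) auto
  also have "\<dots> \<le> \<beta> - 1 / \<beta>"
    using assms by (simp add: field_simps)
  finally show ?thesis .
next
  case False
  have le: "x \<le> x powr \<beta>"
    using powr_mono[of 1 \<beta> x] False assms by simp
  have "x powr \<beta> - x = x powr \<beta> * (1 - x powr - (\<beta> - 1))"
    using assms by (simp add: powr_diff right_diff_distrib powr_add[symmetric])
  also have "\<dots> \<le> x powr \<beta> * ((\<beta> - 1) * ln x)"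
    using one_minus_powr_le[OF assms(1), of "- (\<beta> - 1)"]
    by (intro mult_left_mono) (simp_all only: minus_mult_left minus_minus powr_ge_zero)
  also have "\<dots> \<le> x powr 2 * ((\<beta> - 1) * ln x)"
    using assms False by (intro mult_right_mono powr_mono) auto
  also have "\<dots> = (\<beta> - 1) * (x ^ 2 * ln x)"
    using assms by simp
  also have "\<dots> \<le> (\<beta> - 1) * (3 / 2 * exp x)"
    using assms False by (intro mult_left_mono power2_mult_ln_le) auto
  finally have "\<bar>x - x powr \<beta>\<bar> * exp (- min x (x powr \<beta>)) \<le> (\<beta> - 1) * (3 / 2 * exp x) * exp (- x)"
    using le by (simp add: min_def)
  also have "\<dots> = (\<beta> - 1) * (3 / 2)"
    by (simp add: exp_minus)
  also have "\<dots> \<le> (\<beta> - 1) * (1 + 1 / \<beta>)"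
    using assms by (intro mult_left_mono) (auto simp: field_simps)
  also have "\<dots> = \<beta> - 1 / \<beta>"
    using assms by (simp add: field_simps)
  finally show ?thesis .
qed

lemma max_integral_exp_diff_le:
  fixes \<nu> :: "(real ^ 'n) measure" and x :: "'n \<Rightarrow> real"
  assumes "angular_measure nrm \<nu>" "\<And>j. 0 < x j" "1 < \<beta>"
  shows "\<bar>exp (- max_integral \<nu> x) - exp (- max_integral \<nu> (\<lambda>j. x j powr \<beta>))\<bar>
    \<le> real CARD('n) * (\<beta> - 1 / \<beta>)"
proof (cases "1 \<le> \<beta> - 1 / \<beta>")
  case True
  have nn: "0 \<le> max_integral \<nu> x" "0 \<le> max_integral \<nu> (\<lambda>j. x j powr \<beta>)"
    using order_trans[OF _ max_integral_ge[OF assms(1), of x undefined], of 0]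
      order_trans[OF _ max_integral_ge[OF assms(1), of "\<lambda>j. x j powr \<beta>" undefined], of 0] assms(2)
    by (auto simp: less_imp_le)
  \<comment> \<open>Both exponentials lie in (0, 1], so their distance is at most 1.\<close>
  have "\<bar>exp (- max_integral \<nu> x) - exp (- max_integral \<nu> (\<lambda>j. x j powr \<beta>))\<bar> \<le> 1 * 1"
    using nn exp_le_one_iff[of "- max_integral \<nu> x"]
      exp_le_one_iff[of "- max_integral \<nu> (\<lambda>j. x j powr \<beta>)"]
      exp_gt_zero[of "- max_integral \<nu> x"] exp_gt_zero[of "- max_integral \<nu> (\<lambda>j. x j powr \<beta>)"]
    by linarith
  also have "\<dots> \<le> real CARD('n) * (\<beta> - 1 / \<beta>)"
    using True by (intro mult_mono) (auto simp: Suc_leI)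
  finally show ?thesis .
next
  case False
  have "\<beta> \<le> 2"
  proof (rule ccontr)
    assume "\<not> \<beta> \<le> 2"
    then have "1 / \<beta> < 1" by simp
    with \<open>\<not> \<beta> \<le> 2\<close> False show False by linarith
  qed
  let ?V = "max_integral \<nu> x" and ?W = "max_integral \<nu> (\<lambda>j. x j powr \<beta>)"
  have "\<bar>exp (- ?V) - exp (- ?W)\<bar> \<le> exp (- min ?V ?W) * \<bar>?V - ?W\<bar>"
    by (rule abs_exp_minus_diff_le)
  also have "\<dots> \<le> exp (- min ?V ?W) * (\<Sum>j\<in>UNIV. \<bar>x j - x j powr \<beta>\<bar>)"
    using assms by (intro mult_left_mono max_integral_abs_diff_le) (auto simp: less_imp_le)
  also have "\<dots> = (\<Sum>j\<in>UNIV. \<bar>x j - x j powr \<beta>\<bar> * exp (- min ?V ?W))"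
    by (subst sum_distrib_left) (simp only: mult.commute)
  also have "\<dots> \<le> (\<Sum>j\<in>(UNIV :: 'n set). \<beta> - 1 / \<beta>)"
  proof (rule sum_mono)
    fix j
    \<comment> \<open>The smaller of the two integrals dominates the smaller of x_j and x_j^beta, so
      the common exponential factor is small enough for each summand on its own.\<close>
    have "x j \<le> ?V" "x j powr \<beta> \<le> ?W"
      using max_integral_ge[OF assms(1), of x j] max_integral_ge[OF assms(1), of "\<lambda>j. x j powr \<beta>" j] assms(2)
      by (auto simp: less_imp_le)
    then have "exp (- min ?V ?W) \<le> exp (- min (x j) (x j powr \<beta>))"
      by (auto simp: min_def)
    then have "\<bar>x j - x j powr \<beta>\<bar> * exp (- min ?V ?W)
        \<le> \<bar>x j - x j powr \<beta>\<bar> * exp (- min (x j) (x j powr \<beta>))"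
      by (intro mult_left_mono) auto
    also have "\<dots> \<le> \<beta> - 1 / \<beta>"
      using assms \<open>\<beta> \<le> 2\<close> by (intro powr_diff_mult_exp_le) auto
    finally show "\<bar>x j - x j powr \<beta>\<bar> * exp (- min ?V ?W) \<le> \<beta> - 1 / \<beta>" .
  qed
  also have "\<dots> = real CARD('n) * (\<beta> - 1 / \<beta>)"
    by simp
  finally show ?thesis .
qed

lemma max_stable_kolmogorov_le:
  fixes \<nu> :: "(real ^ 'n) measure"
  assumes "is_norm nrm" "angular_measure nrm \<nu>" "0 < \<alpha>1" "\<alpha>1 < \<alpha>2"
    and "max_stable \<alpha>1 \<nu> M1 Z1" "max_stable \<alpha>2 \<nu> M2 Z2"
  shows "kolmogorov_dist M1 Z1 M2 Z2 \<le> real CARD('n) * (\<alpha>2 / \<alpha>1 - \<alpha>1 / \<alpha>2)"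
  unfolding kolmogorov_dist_def
proof (rule cSUP_least)
  \<comment> \<open>A supremum in the reals is bounded this way only over a nonempty index
    set.\<close>
  have "(\<chi> j. 1) \<in> (pos_orthant :: (real ^ 'n) set)"
    by (simp add: pos_orthant_def)
  then show "(pos_orthant :: (real ^ 'n) set) \<noteq> {}" by blast
next
  fix z :: "real ^ 'n" assume z: "z \<in> pos_orthant"
  \<comment> \<open>Both distribution functions thus depend on the one vector x = z^(-alpha1), the
    second through x^beta with beta = alpha2/alpha1.\<close>
  have "(\<lambda>j. (z $ j) powr - \<alpha>2) = (\<lambda>j. ((z $ j) powr - \<alpha>1) powr (\<alpha>2 / \<alpha>1))"
    using assms by (simp add: powr_powr)
  then show "\<bar>measure M1 {\<omega> \<in> space M1. Z1 \<omega> \<le> z} - measure M2 {\<omega> \<in> space M2. Z2 \<omega> \<le> z}\<bar>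
      \<le> real CARD('n) * (\<alpha>2 / \<alpha>1 - \<alpha>1 / \<alpha>2)"
    using max_integral_exp_diff_le[OF assms(2), of "\<lambda>j. (z $ j) powr - \<alpha>1" "\<alpha>2 / \<alpha>1"] z assms
      max_stable_cdf[OF assms(1,2,3,5) z] max_stable_cdf[OF assms(1,2) _ assms(6) z]
    by (simp add: pos_orthant_def less_imp_neq[symmetric])
qed

subsection \<open>Integrals against the Frechet law and the exponent measure\<close>

text \<open>The Frechet distribution function is prescribed on (0, infinity) only. Tails at x <= 0
  equal the mass of (0, infinity), which is the increasing limit of the tails at 1/(n+1).\<close>

lemma measure_eqI_greaterThan_pos:
  fixes M N :: "real measure"
  assumes sets: "sets M = sets borel" "sets N = sets borel"
    and "finite_measure M"
    and "emeasure M {..0} = 0" "emeasure N {..0} = 0"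
    and eq: "\<And>x. 0 < x \<Longrightarrow> emeasure M {x<..} = emeasure N {x<..}"
  shows "M = N"
proof (rule measure_eqI_lessThan[OF sets])
  interpret M: finite_measure M by fact
  show "emeasure M {x<..} < \<infinity>" for x
    using M.emeasure_finite[of "{x<..}"] by (simp add: less_top[symmetric])
  have U: "{0<..} = (\<Union>n. {1 / real (Suc n)<..})"
  proof (intro equalityI subsetI)
    fix x :: real assume "x \<in> {0<..}"
    then obtain n where "inverse (real (Suc n)) < x"
      using reals_Archimedean[of x] by auto
    then show "x \<in> (\<Union>n. {1 / real (Suc n)<..})"
      by (auto simp: inverse_eq_divide)
  next
    fix x :: real assume "x \<in> (\<Union>n. {1 / real (Suc n)<..})"
    then obtain n where "1 / real (Suc n) < x" by auto
    moreover have "0 < 1 / real (Suc n)" by simp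
    ultimately show "x \<in> {0<..}" by (simp only: greaterThan_iff order_less_trans)
  qed
  have inc: "incseq (\<lambda>n. {1 / real (Suc n)<..})"
    by (intro incseq_SucI, rule greaterThan_subset_iff[THEN iffD2]) (simp add: frac_le)
  have sup: "emeasure L {0<..} = (SUP n. emeasure L {1 / real (Suc n)<..})" if "sets L = sets borel" for L
    unfolding U using that inc 
    by (intro SUP_emeasure_incseq[symmetric] image_subsetI) (simp_all del: of_nat_Suc)
  have null: "emeasure L {x<..} = emeasure L {0<..}"
    if "sets L = sets borel" "emeasure L {..0} = 0" "x \<le> 0" for L and x :: real
  proof -
    have "{x<..} = {0<..} \<union> ({x<..} \<inter> {..0})"
      using that(3) by (intro set_eqI) (simp, linarith)
    moreover have "emeasure L ({x<..} \<inter> {..0}) = 0"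
      by (rule emeasure_eq_0[of "{..0}" L]) (simp_all add: that)
    ultimately show ?thesis
      using that(1) emeasure_Un_null_set[of "{0<..}" L "{x<..} \<inter> {..0}"]
      unfolding null_sets_def by (metis (mono_tags, lifting) borel_open greaterThan_borel
        atMost_borel mem_Collect_eq sets.Int)
  qed
  show "emeasure M {x<..} = emeasure N {x<..}" for x
  proof (cases "0 < x")
    case True
    then show ?thesis by (rule eq)
  next
    case False
    then have "x \<le> 0" by simp
    show ?thesis
      unfolding null[OF sets(1) assms(4) \<open>x \<le> 0\<close>] null[OF sets(2) assms(5) \<open>x \<le> 0\<close>]
        sup[OF sets(1)] sup[OF sets(2)]
      by (intro SUP_cong refl eq) simp
  qed
qed

lemma frechet_nonpos_null:
  assumes "0 < \<alpha>" "frechet \<alpha> M \<zeta>"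
  shows "measure M {\<omega> \<in> space M. \<zeta> \<omega> \<le> 0} = 0"
proof (rule ccontr)
  interpret prob_space M using assms by (simp add: frechet_def)
  have [measurable]: "\<zeta> \<in> borel_measurable M" using assms by (simp add: frechet_def)
  let ?p = "measure M {\<omega> \<in> space M. \<zeta> \<omega> \<le> 0}"
  assume "?p \<noteq> 0"
  then have p: "0 < ?p" by (simp add: zero_less_measure_iff)
  \<comment> \<open>The point x with x^(-alpha) = y gives \<open>?p\<close> <= exp (- y) =
    \<open>?p\<close> / e, which is impossible for positive \<open>?p\<close>.\<close>
  define y where "y = 1 - ln ?p"
  have "0 < y"
    using p ln_le_zero_iff[of ?p] prob_le_1[of "{\<omega> \<in> space M. \<zeta> \<omega> \<le> 0}"]
    unfolding y_def by linarith
  have "?p \<le> measure M {\<omega> \<in> space M. \<zeta> \<omega> \<le> y powr (- 1 / \<alpha>)}"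
    by (intro finite_measure_mono) (auto intro: order_trans)
  also have "\<dots> = exp (- ((y powr (- 1 / \<alpha>)) powr - \<alpha>))"
    using assms \<open>0 < y\<close> by (simp add: frechet_def)
  also have "(y powr (- 1 / \<alpha>)) powr - \<alpha> = y"
    using assms \<open>0 < y\<close> by (subst powr_powr) simp
  also have "exp (- y) = ?p * exp (- 1)"
    using p by (simp add: y_def exp_diff exp_minus field_simps)
  also have "\<dots> < ?p * 1"
    using p by (intro mult_strict_left_mono) auto
  finally show False by simp
qed

text \<open>The derivative of exp (- t^(-alpha)) is the radial density times exp (- t^(-alpha)).
  This turns expectations under the margins into integrals of the kind found in the
  constants.\<close>

lemma nn_integral_frechet:
  fixes f :: "real \<Rightarrow> ennreal"
  assumes "0 < \<alpha>" "frechet \<alpha> M \<zeta>" and [measurable]: "f \<in> borel_measurable borel"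
  shows "(\<integral>\<^sup>+\<omega>. f (\<zeta> \<omega>) \<partial>M) = (\<integral>\<^sup>+t. ennreal (exp (- (t powr - \<alpha>))) * f t \<partial>radial_measure \<alpha>)"
proof -
  interpret prob_space M using assms by (simp add: frechet_def)
  have [measurable]: "\<zeta> \<in> borel_measurable M" using assms by (simp add: frechet_def)
  let ?g = "\<lambda>t. ennreal (\<alpha> * t powr (- \<alpha> - 1)) * ennreal (exp (- (t powr - \<alpha>))) * indicator {0<..} t"
  have "distr M borel \<zeta> = density lborel ?g"
  proof (rule measure_eqI_greaterThan_pos)
    show "finite_measure (distr M borel \<zeta>)"
      by (intro finite_measure_distr) simp
    show "emeasure (distr M borel \<zeta>) {..0} = 0"
      using frechet_nonpos_null[OF assms(1,2)]
      by (simp add: emeasure_distr emeasure_eq_measure vimage_def Int_def conj_commute)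
    have "emeasure (density lborel ?g) {..0} = (\<integral>\<^sup>+t. ?g t * indicator {..0} t \<partial>lborel)"
      by (rule emeasure_density) auto
    also have "\<dots> = (\<integral>\<^sup>+(t::real). 0 \<partial>lborel)"
      by (intro nn_integral_cong) (auto split: split_indicator)
    finally show "emeasure (density lborel ?g) {..0} = 0" by simp
  next
    fix x :: real assume x: "0 < x"
    have "emeasure (distr M borel \<zeta>) {x<..} = ennreal (1 - measure M {\<omega> \<in> space M. \<zeta> \<omega> \<le> x})"
    proof -
      have "\<zeta> -` {x<..} \<inter> space M = space M - {\<omega> \<in> space M. \<zeta> \<omega> \<le> x}" by auto
      then show ?thesis
        by (simp add: emeasure_distr emeasure_eq_measure prob_compl)
    qed
    also have "\<dots> = ennreal (1 - exp (- (x powr - \<alpha>)))"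
      using assms x by (simp add: frechet_def)
    also have "\<dots> = (\<integral>\<^sup>+t. ennreal (\<alpha> * t powr (- \<alpha> - 1) * exp (- (t powr - \<alpha>))) * indicator {x..} t \<partial>lborel)"
    proof (rule nn_integral_FTC_atLeast[symmetric])
      fix t assume "x \<le> t"
      with x assms show "DERIV (\<lambda>t. exp (- (t powr - \<alpha>))) t :> \<alpha> * t powr (- \<alpha> - 1) * exp (- (t powr - \<alpha>))"
        by (auto intro!: derivative_eq_intros)
      show "0 \<le> \<alpha> * t powr (- \<alpha> - 1) * exp (- (t powr - \<alpha>))"
        using assms by simp
    next
      have "((\<lambda>t. exp (- (t powr - \<alpha>))) \<longlongrightarrow> exp (- 0)) at_top"
        using assms by (intro tendsto_intros tendsto_neg_powr filterlim_ident) auto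
      then show "((\<lambda>t. exp (- (t powr - \<alpha>))) \<longlongrightarrow> 1) at_top" by simp
    qed simp
    also have "\<dots> = (\<integral>\<^sup>+t. ?g t * indicator {x<..} t \<partial>lborel)"
      using x assms AE_lborel_singleton[of x]
      by (intro nn_integral_cong_AE)
         (auto elim!: eventually_mono simp: ennreal_mult split: split_indicator)
    also have "\<dots> = emeasure (density lborel ?g) {x<..}"
      by (rule emeasure_density[symmetric]) auto
    finally show "emeasure (distr M borel \<zeta>) {x<..} = emeasure (density lborel ?g) {x<..}" .
  qed auto
  moreover have "(\<integral>\<^sup>+\<omega>. f (\<zeta> \<omega>) \<partial>M) = (\<integral>\<^sup>+t. f t \<partial>distr M borel \<zeta>)"
    by (simp add: nn_integral_distr)
  ultimately have "(\<integral>\<^sup>+\<omega>. f (\<zeta> \<omega>) \<partial>M) = (\<integral>\<^sup>+t. f t \<partial>density lborel ?g)"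
    by (simp only:)
  also have "\<dots> = (\<integral>\<^sup>+t. ?g t * f t \<partial>lborel)"
    by (rule nn_integral_density) auto
  also have "\<dots> = (\<integral>\<^sup>+t. ennreal (exp (- (t powr - \<alpha>))) * f t \<partial>radial_measure \<alpha>)"
    by (subst nn_integral_radial_measure) (auto intro!: nn_integral_cong simp: mult_ac)
  finally show ?thesis .
qed

section \<open>The weight \<open>min_frechet_cdf\<close> of the integrals\<close>

text \<open>Monotone functions are Borel, which makes the integrands of the constants
  measurable.\<close>

lemma mono_min_frechet_cdf:
  assumes "frechet \<alpha> M \<zeta>"
  shows "mono (min_frechet_cdf \<alpha>1 \<alpha>2 M \<zeta>)"
proof (rule monoI)
  interpret prob_space M using assms by (simp add: frechet_def)
  have [measurable]: "\<zeta> \<in> borel_measurable M" using assms by (simp add: frechet_def)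
  fix s t :: real assume "s \<le> t"
  then show "min_frechet_cdf \<alpha>1 \<alpha>2 M \<zeta> s \<le> min_frechet_cdf \<alpha>1 \<alpha>2 M \<zeta> t"
    unfolding min_frechet_cdf_def by (intro finite_measure_mono) auto
qed

lemma min_frechet_cdf_nonneg: "0 \<le> min_frechet_cdf \<alpha>1 \<alpha>2 M \<zeta> t"
  by (simp add: min_frechet_cdf_def)

lemma min_frechet_cdf_le_1:
  assumes "frechet \<alpha> M \<zeta>"
  shows "min_frechet_cdf \<alpha>1 \<alpha>2 M \<zeta> t \<le> 1"
proof -
  interpret prob_space M using assms by (simp add: frechet_def)
  show ?thesis by (simp add: min_frechet_cdf_def)
qed

text \<open>The minimum is at most t whenever zeta is, so the weight dominates the Frechet density
  relative to \<open>radial_measure\<close>.\<close>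

lemma min_frechet_cdf_ge:
  assumes "frechet \<alpha> M \<zeta>" "0 < t"
  shows "exp (- (t powr - \<alpha>)) \<le> min_frechet_cdf \<alpha>1 \<alpha>2 M \<zeta> t"
proof -
  interpret prob_space M using assms by (simp add: frechet_def)
  have [measurable]: "\<zeta> \<in> borel_measurable M" using assms by (simp add: frechet_def)
  have "exp (- (t powr - \<alpha>)) = measure M {\<omega> \<in> space M. \<zeta> \<omega> \<le> t}"
    using assms by (simp add: frechet_def)
  also have "\<dots> \<le> min_frechet_cdf \<alpha>1 \<alpha>2 M \<zeta> t"
    unfolding min_frechet_cdf_def by (intro finite_measure_mono) auto
  finally show ?thesis .
qed

text \<open>For t <= 1 both alternatives of the minimum entail zeta <= t^(alpha1/alpha2). The
  resulting decay at 0 beats every power, in particular the singularity of the radial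
  density.\<close>

lemma min_frechet_cdf_le_exp:
  assumes "frechet \<alpha>1 M \<zeta>" "0 < \<alpha>1" "\<alpha>1 < \<alpha>2" "0 < t" "t \<le> 1"
  shows "min_frechet_cdf \<alpha>1 \<alpha>2 M \<zeta> t \<le> exp (- (t powr - (\<alpha>1\<^sup>2 / \<alpha>2)))"
proof -
  interpret prob_space M using assms by (simp add: frechet_def)
  have [measurable]: "\<zeta> \<in> borel_measurable M" using assms by (simp add: frechet_def)
  have "x \<le> t powr (\<alpha>1 / \<alpha>2)" if le: "min (x powr (\<alpha>2 / \<alpha>1)) x \<le> t" for x
  proof -
    \<comment> \<open>Values x <= 0 are settled by the nonnegativity of the right-hand side, without
      evaluating \<open>powr\<close> there.\<close>
    consider "x \<le> 0" | "0 < x" "x \<le> t" | "0 < x" "x powr (\<alpha>2 / \<alpha>1) \<le> t"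
      using le by linarith
    then show ?thesis
    proof cases
      case 1
      then show ?thesis by (rule order_trans) simp
    next
      case 2
      moreover have "t powr 1 \<le> t powr (\<alpha>1 / \<alpha>2)"
        using assms by (intro powr_mono') auto
      ultimately show ?thesis using assms by simp
    next
      case 3
      then have "(x powr (\<alpha>2 / \<alpha>1)) powr (\<alpha>1 / \<alpha>2) \<le> t powr (\<alpha>1 / \<alpha>2)"
        using assms by (intro powr_mono2) auto
      then show ?thesis using 3 assms by (simp add: powr_powr)
    qed
  qed
  then have "min_frechet_cdf \<alpha>1 \<alpha>2 M \<zeta> t \<le> measure M {\<omega> \<in> space M. \<zeta> \<omega> \<le> t powr (\<alpha>1 / \<alpha>2)}"
    unfolding min_frechet_cdf_def by (intro finite_measure_mono) auto
  also have "\<dots> = exp (- ((t powr (\<alpha>1 / \<alpha>2)) powr - \<alpha>1))"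
    using assms by (simp add: frechet_def)
  also have "(t powr (\<alpha>1 / \<alpha>2)) powr - \<alpha>1 = t powr - (\<alpha>1\<^sup>2 / \<alpha>2)"
    by (subst powr_powr) (simp add: power2_eq_square)
  finally show ?thesis .
qed

section \<open>Finiteness of the integrals in the constants\<close>

text \<open>This is s/p <= exp (s/p) raised to the power p; it is applied at s = t^(-gamma).\<close>

lemma powr_mult_exp_minus_le:
  fixes s p :: real
  assumes "0 < s" "0 < p"
  shows "s powr p * exp (- s) \<le> p powr p"
proof -
  have "s / p \<le> exp (s / p)"
    using exp_ge_add_one_self[of "s / p"] by linarith
  then have "(s / p) powr p \<le> exp (s / p) powr p"
    using assms by (intro powr_mono2) auto
  also have "\<dots> = exp s"
    using assms by (simp add: powr_def)
  finally show ?thesis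
    using assms by (simp add: powr_divide exp_minus field_simps)
qed

text \<open>The exponents \<open>\<kappa> = 0\<close> and \<open>\<kappa> = 1\<close> give the integrands of the two constants.\<close>

definition log_integrand :: "real \<Rightarrow> (real \<Rightarrow> real) \<Rightarrow> real \<Rightarrow> real" where
  "log_integrand \<kappa> G t = (if t = 0 then 0 else max 1 t powr \<kappa> * \<bar>ln t\<bar> * G t)"

lemma log_integrand_measurable [measurable]:
  "G \<in> borel_measurable borel \<Longrightarrow> log_integrand \<kappa> G \<in> borel_measurable borel"
proof -
  assume [measurable]: "G \<in> borel_measurable borel"
  have [measurable]: "Measurable.pred borel (\<lambda>t::real. t = 0)"
    by (simp add: pred_def)
  show ?thesis
    unfolding log_integrand_def[abs_def] by measurable
qed

lemma log_integrand_nonneg: "(\<And>t. 0 \<le> G t) \<Longrightarrow> 0 \<le> log_integrand \<kappa> G t"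
  by (simp add: log_integrand_def)

text \<open>Near 0 the decay of G beats the singularity t^(-alpha-1) and the logarithm. At infinity
  t^kappa ln t is integrable against t^(-alpha-1) because kappa < alpha.\<close>

lemma nn_integral_log_integrand_finite:
  fixes G :: "real \<Rightarrow> real"
  assumes [measurable]: "G \<in> borel_measurable borel"
    and G: "\<And>t. 0 \<le> G t" "\<And>t. G t \<le> 1"
    and G_exp: "\<And>t. 0 < t \<Longrightarrow> t \<le> 1 \<Longrightarrow> G t \<le> exp (- (t powr - \<gamma>))"
    and "0 < \<gamma>" "0 < \<alpha>" "\<kappa> < \<alpha>"
  shows "(\<integral>\<^sup>+t. ennreal (log_integrand \<kappa> G t) \<partial>radial_measure \<alpha>) < \<infinity>"
proof -
  \<comment> \<open>Chosen so that gamma p = alpha + 2: the density contributes alpha + 1 and the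
    bound |ln t| <= 1/t one more.\<close>
  define p where "p = (\<alpha> + 2) / \<gamma>"
  \<comment> \<open>Half of the gap alpha - kappa pays for ln t <= t^delta / delta; the other half
    leaves the integrable power t^(-delta-1).\<close>
  define \<delta> where "\<delta> = (\<alpha> - \<kappa>) / 2"
  have p: "0 < p" and \<delta>: "0 < \<delta>"
    using assms by (simp_all add: p_def \<delta>_def)
  define C where "C = \<alpha> * p powr p"
  \<comment> \<open>One factor 1/delta comes from the logarithm. The other completes the density of
    \<open>radial_measure\<close> with parameter delta, which gives (1, infinity) mass 1.\<close>
  define C' where "C' = \<alpha> / \<delta>\<^sup>2"
  have nn: "0 \<le> C" "0 \<le> C'"
    using assms by (simp_all add: C_def C'_def)
  have small: "\<alpha> * t powr (- \<alpha> - 1) * log_integrand \<kappa> G t \<le> C" if t: "0 < t" "t \<le> 1" for t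
  proof -
    have "\<bar>ln t\<bar> = ln (inverse t)"
      using t by (simp add: ln_inverse)
    also have "\<dots> \<le> inverse t - 1"
      using t by (intro ln_le_minus_one) auto
    also have "\<dots> \<le> t powr - 1"
      using t by (simp add: powr_minus)
    finally have "\<bar>ln t\<bar> * G t \<le> t powr - 1 * exp (- (t powr - \<gamma>))"
      using t G G_exp by (intro mult_mono) auto
    then have "log_integrand \<kappa> G t \<le> t powr - 1 * exp (- (t powr - \<gamma>))"
      using t by (simp add: log_integrand_def)
    then have "\<alpha> * t powr (- \<alpha> - 1) * log_integrand \<kappa> G t
        \<le> \<alpha> * t powr (- \<alpha> - 1) * (t powr - 1 * exp (- (t powr - \<gamma>)))"
      using assms by (intro mult_left_mono) auto
    also have "\<dots> = \<alpha> * ((t powr - \<gamma>) powr p * exp (- (t powr - \<gamma>)))"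
    proof -
      have "t powr (- \<alpha> - 1) * t powr - 1 = t powr (- \<alpha> - 2)"
        unfolding powr_add[symmetric] by (rule arg_cong2[where f="(powr)"]) auto
      also have "\<dots> = (t powr - \<gamma>) powr p"
        using assms by (simp add: powr_powr p_def)
      finally have eq: "(t powr - \<gamma>) powr p = t powr (- \<alpha> - 1) * t powr - 1" ..
      show ?thesis unfolding eq by (simp only: mult.assoc)
    qed
    also have "\<dots> \<le> C"
      unfolding C_def using assms p t by (intro mult_left_mono powr_mult_exp_minus_le) auto
    finally show ?thesis .
  qed
  have large: "\<alpha> * t powr (- \<alpha> - 1) * log_integrand \<kappa> G t \<le> C' * (\<delta> * t powr (- \<delta> - 1))"
    if t: "1 < t" for t
  proof -
    have "\<bar>ln t\<bar> \<le> t powr \<delta> / \<delta>"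
      using t \<delta> ln_powr_bound[of t \<delta>] by simp
    then have "t powr \<kappa> * \<bar>ln t\<bar> * G t \<le> t powr \<kappa> * (t powr \<delta> / \<delta>) * 1"
      using G \<delta> by (intro mult_mono mult_left_mono) auto
    then have "log_integrand \<kappa> G t \<le> t powr \<kappa> * (t powr \<delta> / \<delta>) * 1"
      unfolding log_integrand_def using t by simp
    then have "\<alpha> * t powr (- \<alpha> - 1) * log_integrand \<kappa> G t
        \<le> \<alpha> * t powr (- \<alpha> - 1) * (t powr \<kappa> * (t powr \<delta> / \<delta>) * 1)"
      using assms by (intro mult_left_mono) auto
    also have "\<dots> = \<alpha> / \<delta> * (t powr (- \<alpha> - 1) * t powr \<kappa> * t powr \<delta>)"
      by simp
    also have "t powr (- \<alpha> - 1) * t powr \<kappa> * t powr \<delta> = t powr (- \<delta> - 1)"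
      unfolding powr_add[symmetric] by (rule arg_cong2[where f="(powr)"]) (auto simp: \<delta>_def field_simps)
    also have "\<alpha> / \<delta> * t powr (- \<delta> - 1) = C' * (\<delta> * t powr (- \<delta> - 1))"
      using \<delta> by (simp add: C'_def power2_eq_square)
    finally show ?thesis .
  qed
  have "(\<integral>\<^sup>+t. ennreal (log_integrand \<kappa> G t) \<partial>radial_measure \<alpha>)
      = (\<integral>\<^sup>+t. ennreal (\<alpha> * t powr (- \<alpha> - 1)) * ennreal (log_integrand \<kappa> G t) * indicator {0<..} t \<partial>lborel)"
    by (rule nn_integral_radial_measure) simp
  also have "\<dots> \<le> (\<integral>\<^sup>+t. ennreal C * indicator {0<..1} t
      + ennreal C' * (ennreal (\<delta> * t powr (- \<delta> - 1)) * indicator {1<..} t * indicator {0<..} t) \<partial>lborel)"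
  proof (rule nn_integral_mono)
    fix t :: real
    consider "t \<le> 0" | "0 < t" "t \<le> 1" | "1 < t" by linarith
    then show "ennreal (\<alpha> * t powr (- \<alpha> - 1)) * ennreal (log_integrand \<kappa> G t) * indicator {0<..} t
        \<le> ennreal C * indicator {0<..1} t
          + ennreal C' * (ennreal (\<delta> * t powr (- \<delta> - 1)) * indicator {1<..} t * indicator {0<..} t)"
    proof cases
      case 2
      then show ?thesis
        using small[of t] assms log_integrand_nonneg[of G \<kappa> t]
        by (auto simp: ennreal_mult[symmetric] intro!: ennreal_leI)
    next
      case 3
      then show ?thesis
        using large[of t] assms \<delta> nn log_integrand_nonneg[of G \<kappa> t]
        by (auto simp: ennreal_mult[symmetric] intro!: ennreal_leI)
    qed simp
  qed
  also have "\<dots> = ennreal C * emeasure lborel {0<..1::real}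
      + ennreal C' * (\<integral>\<^sup>+t. ennreal (\<delta> * t powr (- \<delta> - 1)) * indicator {1<..} t * indicator {0<..} t \<partial>lborel)"
    by (subst nn_integral_add) (auto simp: nn_integral_cmult nn_integral_cmult_indicator)
  also have "(\<integral>\<^sup>+t. ennreal (\<delta> * t powr (- \<delta> - 1)) * indicator {1<..} t * indicator {0<..} t \<partial>lborel)
      = (\<integral>\<^sup>+t. indicator {1<..} t \<partial>radial_measure \<delta>)"
    by (rule nn_integral_radial_measure[symmetric]) simp
  also have "\<dots> = emeasure (radial_measure \<delta>) {1<..}"
    by (intro nn_integral_indicator)
       (auto simp: sets_radial_measure sets_restrict_space intro!: image_eqI[of _ _ "{1<..}"])
  also have "\<dots> = 1"
    using \<delta> by (subst emeasure_radial_measure_greaterThan) auto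
  also have "ennreal C * emeasure lborel {0<..1::real} + ennreal C' * 1 < \<infinity>"
    by (simp add: ennreal_add_less_top)
  finally show ?thesis .
qed

lemma exponent_measure_integral_nth:
  fixes \<nu> :: "(real ^ 'n) measure" and f :: "real \<Rightarrow> real"
  assumes "is_norm nrm" "angular_measure nrm \<nu>" "0 < \<alpha>"
    and [measurable]: "f \<in> borel_measurable borel" and "f 0 = 0" "\<And>t. 0 \<le> f t"
    and fin: "(\<integral>\<^sup>+t. ennreal (f t) \<partial>radial_measure \<alpha>) < \<infinity>"
  shows "integrable (exponent_measure \<alpha> \<nu>) (\<lambda>y. f (y $ j))"
    and "(\<integral>y. f (y $ j) \<partial>exponent_measure \<alpha> \<nu>) = enn2real (\<integral>\<^sup>+t. ennreal (f t) \<partial>radial_measure \<alpha>)"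
proof -
  have [measurable]: "(\<lambda>y. f (y $ j)) \<in> borel_measurable (exponent_measure \<alpha> \<nu>)"
    by (auto simp: exponent_measure_def intro!: measurable_restrict_space1)
  have eq: "(\<integral>\<^sup>+y. ennreal (f (y $ j)) \<partial>exponent_measure \<alpha> \<nu>) = (\<integral>\<^sup>+t. ennreal (f t) \<partial>radial_measure \<alpha>)"
    using assms by (intro nn_integral_exponent_measure_nth[where f="\<lambda>t. ennreal (f t)"]) auto
  show "integrable (exponent_measure \<alpha> \<nu>) (\<lambda>y. f (y $ j))"
    using assms eq by (intro integrableI_nonneg) auto
  show "(\<integral>y. f (y $ j) \<partial>exponent_measure \<alpha> \<nu>) = enn2real (\<integral>\<^sup>+t. ennreal (f t) \<partial>radial_measure \<alpha>)"
    using assms eq by (subst integral_eq_nn_integral) auto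
qed

subsection \<open>The Wasserstein distance\<close>

text \<open>Lower orthants are closed under intersection and generate the Borel sets, and those with
  corners (i, ..., i) exhaust the space.\<close>

lemma distr_eqI_cdf:
  fixes X :: "'a \<Rightarrow> real ^ 'n" and Y :: "'b \<Rightarrow> real ^ 'n"
  assumes "prob_space M" "prob_space N"
    and X [measurable]: "X \<in> borel_measurable M" and Y [measurable]: "Y \<in> borel_measurable N"
    and eq: "\<And>z. measure M {\<omega> \<in> space M. X \<omega> \<le> z} = measure N {\<omega> \<in> space N. Y \<omega> \<le> z}"
  shows "distr M borel X = distr N borel Y"
proof -
  interpret M: prob_space M by fact
  interpret N: prob_space N by fact
  let ?E = "range (\<lambda>a::real ^ 'n. {..a})"
  have sets: "sets borel = sigma_sets UNIV ?E"
    unfolding borel_eq_atMost by (intro sets_measure_of) auto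
  have gen: "{..a} \<in> sets borel" for a :: "real ^ 'n"
    unfolding sets by (intro sigma_sets.Basic) auto
  show ?thesis
  proof (rule measure_eqI_generator_eq[where E="?E" and \<Omega>=UNIV and A="\<lambda>i. {..\<chi> j. real i}"])
    show "Int_stable ?E"
    proof (rule Int_stableI_image)
      fix a b :: "real ^ 'n"
      have "{..a} \<inter> {..b} = {..inf a b}" by auto
      then show "\<exists>c\<in>UNIV. {..a} \<inter> {..b} = {..c}" by blast
    qed
    fix S assume "S \<in> ?E"
    then obtain z where S: "S = {..z}" by auto
    have "X -` {..z} \<inter> space M = {\<omega> \<in> space M. X \<omega> \<le> z}"
      "Y -` {..z} \<inter> space N = {\<omega> \<in> space N. Y \<omega> \<le> z}" by auto
    then show "emeasure (distr M borel X) S = emeasure (distr N borel Y) S"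
      unfolding S using eq[of z] gen[of z]
      by (simp add: emeasure_distr M.emeasure_eq_measure N.emeasure_eq_measure)
  next
    have "x \<in> (\<Union>i. {..\<chi> j. real i})" for x :: "real ^ 'n"
    proof -
      obtain i where "norm x < real i" using reals_Archimedean2 by blast
      then have "x $ j \<le> real i" for j
        using component_le_norm_cart[of x j] by linarith
      then show ?thesis by (auto simp: less_eq_vec_def)
    qed
    then show "(\<Union>i. {..\<chi> j. real i}) = (UNIV :: (real ^ 'n) set)" by blast
    show "emeasure (distr M borel X) {..\<chi> j. real i} \<noteq> \<infinity>" for i
      using gen by (simp add: emeasure_distr M.emeasure_eq_measure)
  qed (use sets in auto)
qed

lemma max_stable_measurable:
  assumes "max_stable \<alpha> \<nu> M Z"
  shows "Z \<in> borel_measurable M"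
  using assms by (simp add: max_stable_def measurable_restrict_space2_iff)

lemma max_stable_pos:
  assumes "max_stable \<alpha> \<nu> M Z" "\<omega> \<in> space M"
  shows "0 < Z \<omega> $ j"
  using assms measurable_space[of Z M "restrict_space borel pos_orthant" \<omega>]
  by (simp add: max_stable_def space_restrict_space pos_orthant_def)

text \<open>Let the other coordinates tend to infinity. The exponent is squeezed between t^(-alpha),
  by \<open>max_integral_ge\<close>, and the sum of the weights, whose other terms tend to 0. The
  events increase, so their probabilities converge to that of the union.\<close>

lemma max_stable_frechet:
  fixes \<nu> :: "(real ^ 'n) measure"
  assumes "is_norm nrm" "angular_measure nrm \<nu>" "0 < \<alpha>" "max_stable \<alpha> \<nu> M Z"
  shows "frechet \<alpha> M (\<lambda>\<omega>. Z \<omega> $ j)"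
  unfolding frechet_def
proof (intro conjI allI impI)
  show "prob_space M" using assms by (simp add: max_stable_def)
  then interpret prob_space M .
  note [measurable] = max_stable_measurable[OF assms(4)]
  show "(\<lambda>\<omega>. Z \<omega> $ j) \<in> borel_measurable M" by measurable
  fix t :: real assume t: "0 < t"
  \<comment> \<open>\<open>real (Suc n)\<close> rather than n keeps every corner in
    \<open>pos_orthant\<close>, where the distribution function is known.\<close>
  define z where "z n = (\<chi> k. if k = j then t else real (Suc n))" for n
  define w where "w n k = (if k = j then t powr - \<alpha> else real (Suc n) powr - \<alpha>)" for n k
  have z: "z n \<in> pos_orthant" for n
    using t by (simp add: z_def pos_orthant_def)
  have w: "(\<lambda>k. (z n $ k) powr - \<alpha>) = w n" for n
    by (auto simp: z_def w_def)
  have w_nonneg: "0 \<le> w n k" for n k by (simp add: w_def)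
  have cdf: "measure M {\<omega> \<in> space M. Z \<omega> \<le> z n} = exp (- max_integral \<nu> (w n))" for n
    using max_stable_cdf[OF assms z] by (simp add: w)
  have "(\<lambda>n. max_integral \<nu> (w n)) \<longlonglongrightarrow> t powr - \<alpha>"
  proof (rule real_tendsto_sandwich)
    show "\<forall>\<^sub>F n in sequentially. t powr - \<alpha> \<le> max_integral \<nu> (w n)"
      using max_integral_ge[OF assms(2), of "w _" j, OF w_nonneg] by (intro always_eventually) (simp add: w_def)
    show "\<forall>\<^sub>F n in sequentially. max_integral \<nu> (w n) \<le> (\<Sum>k\<in>UNIV. w n k)"
      using max_integral_diff_le[OF assms(2), of "w _" "\<lambda>_. 0", OF w_nonneg]
      by (intro always_eventually) (simp add: max_integral_def w_nonneg max_absorb2)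
    have "(\<lambda>n. real (Suc n) powr - \<alpha>) \<longlonglongrightarrow> 0"
      using assms(3) by (intro tendsto_neg_powr filterlim_compose[OF filterlim_real_sequentially filterlim_Suc]) auto
    then have "(\<lambda>n. \<Sum>k\<in>UNIV. w n k) \<longlonglongrightarrow> (\<Sum>k\<in>UNIV. if k = j then t powr - \<alpha> else 0)"
      unfolding w_def by (intro tendsto_sum) (simp split: if_split del: of_nat_Suc)
    then show "(\<lambda>n. \<Sum>k\<in>UNIV. w n k) \<longlonglongrightarrow> t powr - \<alpha>"
      by simp
  qed simp
  then have lim: "(\<lambda>n. measure M {\<omega> \<in> space M. Z \<omega> \<le> z n}) \<longlonglongrightarrow> exp (- (t powr - \<alpha>))"
    unfolding cdf by (intro tendsto_intros)
  have lim_Un: "(\<lambda>n. measure M {\<omega> \<in> space M. Z \<omega> \<le> z n}) \<longlonglongrightarrow> measure M (\<Union>n. {\<omega> \<in> space M. Z \<omega> \<le> z n})"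
  proof (rule finite_Lim_measure_incseq)
    have "{\<omega> \<in> space M. Z \<omega> \<le> z n} = {\<omega> \<in> space M. \<forall>k\<in>UNIV. Z \<omega> $ k \<le> z n $ k}" for n
      by (simp add: less_eq_vec_def)
    also have "\<dots> n \<in> sets M" for n by measurable
    finally show "range (\<lambda>n. {\<omega> \<in> space M. Z \<omega> \<le> z n}) \<subseteq> sets M" by auto
    show "incseq (\<lambda>n. {\<omega> \<in> space M. Z \<omega> \<le> z n})"
    proof (rule incseq_SucI, clarsimp)
      fix n \<omega> assume "Z \<omega> \<le> z n"
      also have "z n \<le> z (Suc n)" by (simp add: z_def less_eq_vec_def)
      finally show "Z \<omega> \<le> z (Suc n)" .
    qed
  qed
  have Un: "(\<Union>n. {\<omega> \<in> space M. Z \<omega> \<le> z n}) = {\<omega> \<in> space M. Z \<omega> $ j \<le> t}"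
  proof (intro equalityI subsetI)
    fix \<omega> assume "\<omega> \<in> (\<Union>n. {\<omega> \<in> space M. Z \<omega> \<le> z n})"
    then obtain n where "\<omega> \<in> space M" "Z \<omega> \<le> z n" by auto
    then have "\<omega> \<in> space M" "Z \<omega> $ j \<le> z n $ j" by (auto simp: less_eq_vec_def)
    then show "\<omega> \<in> {\<omega> \<in> space M. Z \<omega> $ j \<le> t}" by (simp add: z_def)
  next
    fix \<omega> assume \<omega>: "\<omega> \<in> {\<omega> \<in> space M. Z \<omega> $ j \<le> t}"
    obtain n where "norm (Z \<omega>) < real n" using reals_Archimedean2 by blast
    then have "Z \<omega> $ k \<le> real (Suc n)" for k
      using component_le_norm_cart[of "Z \<omega>" k] by simp
    with \<omega> have "Z \<omega> \<le> z n" by (auto simp: less_eq_vec_def z_def)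
    with \<omega> show "\<omega> \<in> (\<Union>n. {\<omega> \<in> space M. Z \<omega> \<le> z n})" by auto
  qed
  show "measure M {\<omega> \<in> space M. Z \<omega> $ j \<le> t} = exp (- (t powr - \<alpha>))"
    by (rule LIMSEQ_unique[OF lim_Un[unfolded Un] lim])
qed

text \<open>The power of Z1 lies below z exactly when Z1 lies below z^(alpha2/alpha1), and this
  corner turns the exponent - alpha1 into - alpha2.\<close>

lemma max_stable_distr_powr:
  fixes \<nu> :: "(real ^ 'n) measure"
  assumes "is_norm nrm" "angular_measure nrm \<nu>" "0 < \<alpha>1" "0 < \<alpha>2"
    and ms: "max_stable \<alpha>1 \<nu> M1 Z1" "max_stable \<alpha>2 \<nu> M2 Z2"
  shows "distr M2 borel Z2 = distr M1 borel (\<lambda>\<omega>. \<chi> j. (Z1 \<omega> $ j) powr (\<alpha>1 / \<alpha>2))"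
proof (rule distr_eqI_cdf)
  show "prob_space M1" "prob_space M2" using ms by (simp_all add: max_stable_def)
  note [measurable] = max_stable_measurable[OF ms(1)] max_stable_measurable[OF ms(2)]
  show "Z2 \<in> borel_measurable M2"
    "(\<lambda>\<omega>. \<chi> j. (Z1 \<omega> $ j) powr (\<alpha>1 / \<alpha>2)) \<in> borel_measurable M1" by measurable
  fix z :: "real ^ 'n"
  show "measure M2 {\<omega> \<in> space M2. Z2 \<omega> \<le> z}
    = measure M1 {\<omega> \<in> space M1. (\<chi> j. (Z1 \<omega> $ j) powr (\<alpha>1 / \<alpha>2)) \<le> z}"
  proof (cases "z \<in> pos_orthant")
    case True
    then have z: "0 < z $ j" for j by (simp add: pos_orthant_def)
    let ?z = "\<chi> j. (z $ j) powr (\<alpha>2 / \<alpha>1)"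
    have "x powr (\<alpha>1 / \<alpha>2) \<le> z $ j \<longleftrightarrow> x \<le> (z $ j) powr (\<alpha>2 / \<alpha>1)" if "0 < x" for x j
    proof -
      have "x powr (\<alpha>1 / \<alpha>2) \<le> z $ j
          \<longleftrightarrow> x powr (\<alpha>1 / \<alpha>2) \<le> ((z $ j) powr (\<alpha>2 / \<alpha>1)) powr (\<alpha>1 / \<alpha>2)"
        using z[of j] assms(3,4) by (simp add: powr_powr)
      also have "\<dots> \<longleftrightarrow> x \<le> (z $ j) powr (\<alpha>2 / \<alpha>1)"
        using that assms(3,4) powr_less_powr_iff[of "\<alpha>1 / \<alpha>2" "(z $ j) powr (\<alpha>2 / \<alpha>1)" x]
        by (simp add: not_less[symmetric])
      finally show ?thesis .
    qed
    then have "{\<omega> \<in> space M1. (\<chi> j. (Z1 \<omega> $ j) powr (\<alpha>1 / \<alpha>2)) \<le> z} = {\<omega> \<in> space M1. Z1 \<omega> \<le> ?z}"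
      using max_stable_pos[OF ms(1)] by (auto simp: less_eq_vec_def)
    moreover have "?z \<in> pos_orthant" using z by (simp add: pos_orthant_def less_imp_neq[symmetric])
    moreover have "(\<lambda>j. (?z $ j) powr - \<alpha>1) = (\<lambda>j. (z $ j) powr - \<alpha>2)"
      using assms(3) by (simp add: powr_powr)
    ultimately show ?thesis
      using max_stable_cdf[OF assms(1,2,3) ms(1), of ?z] max_stable_cdf[OF assms(1,2,4) ms(2) True]
      by simp
  next
    \<comment> \<open>Off the open orthant both events are empty, as both vectors have positive
      components.\<close>
    case False
    then obtain j where j: "z $ j \<le> 0" by (auto simp: pos_orthant_def not_less)
    have "\<not> Z2 \<omega> \<le> z" if "\<omega> \<in> space M2" for \<omega>
      using max_stable_pos[OF ms(2) that, of j] j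
      by (auto simp: less_eq_vec_def not_le intro!: exI[of _ j])
    then have "{\<omega> \<in> space M2. Z2 \<omega> \<le> z} = {}" by auto
    moreover have "{\<omega> \<in> space M1. (\<chi> j. (Z1 \<omega> $ j) powr (\<alpha>1 / \<alpha>2)) \<le> z} = {}"
    proof -
      have "\<not> (\<chi> j. (Z1 \<omega> $ j) powr (\<alpha>1 / \<alpha>2)) \<le> z" if "\<omega> \<in> space M1" for \<omega>
      proof
        assume "(\<chi> j. (Z1 \<omega> $ j) powr (\<alpha>1 / \<alpha>2)) \<le> z"
        then have "(Z1 \<omega> $ j) powr (\<alpha>1 / \<alpha>2) \<le> z $ j" by (simp add: less_eq_vec_def)
        moreover have "0 < (Z1 \<omega> $ j) powr (\<alpha>1 / \<alpha>2)"
          using max_stable_pos[OF ms(1) that, of j] by simp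
        ultimately show False using j by linarith
      qed
      then show ?thesis by auto
    qed
    ultimately show ?thesis by (simp only: measure_empty)
  qed
qed

text \<open>Factor out the larger of x and x^c and apply \<open>one_minus_powr_le\<close> to the
  quotient, with exponent c - 1 for x >= 1 and 1 - c for x < 1.\<close>

lemma abs_diff_powr_le:
  fixes x c :: real
  assumes "0 < x" "0 < c" "c \<le> 1"
  shows "\<bar>x - x powr c\<bar> \<le> (1 - c) * (max 1 x * \<bar>ln x\<bar>)"
proof (cases "1 \<le> x")
  case True
  have "x powr c \<le> x"
    using powr_mono[of c 1 x] True assms by simp
  moreover have "x - x powr c = x * (1 - x powr (c - 1))"
    using assms by (simp add: powr_diff field_simps)
  moreover have "x * (1 - x powr (c - 1)) \<le> x * - ((c - 1) * ln x)"
    using assms by (intro mult_left_mono one_minus_powr_le) auto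
  ultimately show ?thesis
    using True by (simp add: algebra_simps)
next
  case False
  have "x \<le> x powr c"
    using powr_mono'[of c 1 x] False assms by simp
  moreover have "x powr c - x = x powr c * (1 - x powr (1 - c))"
    using assms by (simp add: right_diff_distrib powr_add[symmetric])
  moreover have "x powr c * (1 - x powr (1 - c)) \<le> 1 * - ((1 - c) * ln x)"
  proof (intro mult_mono one_minus_powr_le)
    show "x powr c \<le> 1" using False assms by (intro powr_le1) auto
    show "0 \<le> 1 - x powr (1 - c)" using False assms powr_le1[of "1 - c" x] by simp
  qed (use assms in auto)
  ultimately show ?thesis
    using False assms by (simp add: algebra_simps)
qed

text \<open>A function in \<open>lipschitz1\<close> may be non-measurable off the orthant, so it is composed with the
  projection onto the orthant.\<close>

lemma lipschitz1_clamp_measurable: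
  fixes h :: "real ^ 'n \<Rightarrow> real"
  assumes "lipschitz1 h"
  shows "(\<lambda>x. h (\<chi> j. max 0 (x $ j))) \<in> borel_measurable borel"
proof (rule borel_measurable_continuous_onI, rule lipschitz_on_continuous_on, rule lipschitz_onI)
  fix x y :: "real ^ 'n"
  have "\<bar>h (\<chi> j. max 0 (x $ j)) - h (\<chi> j. max 0 (y $ j))\<bar> \<le> (\<Sum>j\<in>UNIV. \<bar>max 0 (x $ j) - max 0 (y $ j)\<bar>)"
    using assms[unfolded lipschitz1_def, rule_format,
        of "\<chi> j. max 0 (x $ j)" "\<chi> j. max 0 (y $ j)"]
    by (simp add: nonneg_orthant_def)
  \<comment> \<open>Bounding every coordinate by the Euclidean distance is crude, but only
    continuity is wanted.\<close>
  also have "\<dots> \<le> (\<Sum>j\<in>(UNIV :: 'n set). dist x y)"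
  proof (rule sum_mono)
    fix j
    have "\<bar>max 0 (x $ j) - max 0 (y $ j)\<bar> \<le> \<bar>(x - y) $ j\<bar>" by simp
    also have "\<dots> \<le> dist x y"
      unfolding dist_norm by (rule component_le_norm_cart)
    finally show "\<bar>max 0 (x $ j) - max 0 (y $ j)\<bar> \<le> dist x y" .
  qed
  finally show "dist (h (\<chi> j. max 0 (x $ j))) (h (\<chi> j. max 0 (y $ j))) \<le> real CARD('n) * dist x y"
    by (simp add: dist_real_def)
qed simp

text \<open>Here G is any majorant of the Frechet density relative to \<open>radial_measure\<close>,
  so the logarithmic moment lies below the integral with weight G.\<close>

lemma frechet_log_moment:
  assumes "1 < \<alpha>" "frechet \<alpha> M X" "\<And>\<omega>. \<omega> \<in> space M \<Longrightarrow> 0 < X \<omega>"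
    and G [measurable]: "G \<in> borel_measurable borel" and G_nonneg: "\<And>t. 0 \<le> G t"
    and G_ge: "\<And>t. 0 < t \<Longrightarrow> exp (- (t powr - \<alpha>)) \<le> G t"
    and fin: "(\<integral>\<^sup>+t. ennreal (log_integrand 1 G t) \<partial>radial_measure \<alpha>) < \<infinity>"
  shows "integrable M (\<lambda>\<omega>. max 1 (X \<omega>) * \<bar>ln (X \<omega>)\<bar>)"
    and "(\<integral>\<omega>. max 1 (X \<omega>) * \<bar>ln (X \<omega>)\<bar> \<partial>M)
      \<le> enn2real (\<integral>\<^sup>+t. ennreal (log_integrand 1 G t) \<partial>radial_measure \<alpha>)"
    and "integrable M X"
proof -
  interpret prob_space M using assms by (simp add: frechet_def)
  have [measurable]: "X \<in> borel_measurable M" using assms by (simp add: frechet_def)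
  have "(\<integral>\<^sup>+\<omega>. ennreal (max 1 (X \<omega>) * \<bar>ln (X \<omega>)\<bar>) \<partial>M)
      = (\<integral>\<^sup>+t. ennreal (exp (- (t powr - \<alpha>))) * ennreal (max 1 t * \<bar>ln t\<bar>) \<partial>radial_measure \<alpha>)"
    using assms(1) by (intro nn_integral_frechet[OF _ assms(2), where f="\<lambda>t. ennreal (max 1 t * \<bar>ln t\<bar>)"]) auto
  also have "\<dots> \<le> (\<integral>\<^sup>+t. ennreal (log_integrand 1 G t) \<partial>radial_measure \<alpha>)"
  proof (rule nn_integral_mono)
    fix t assume "t \<in> space (radial_measure \<alpha>)"
    then have t: "0 < t" by simp
    have "max 1 t * \<bar>ln t\<bar> * exp (- (t powr - \<alpha>)) \<le> max 1 t * \<bar>ln t\<bar> * G t"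
      using G_ge[OF t] t by (intro mult_left_mono) auto
    then show "ennreal (exp (- (t powr - \<alpha>))) * ennreal (max 1 t * \<bar>ln t\<bar>) \<le> ennreal (log_integrand 1 G t)"
      using t by (simp add: ennreal_mult[symmetric] log_integrand_def mult_ac ennreal_leI)
  qed
  finally have le: "(\<integral>\<^sup>+\<omega>. ennreal (max 1 (X \<omega>) * \<bar>ln (X \<omega>)\<bar>) \<partial>M)
      \<le> (\<integral>\<^sup>+t. ennreal (log_integrand 1 G t) \<partial>radial_measure \<alpha>)" .
  show int: "integrable M (\<lambda>\<omega>. max 1 (X \<omega>) * \<bar>ln (X \<omega>)\<bar>)"
    using le fin by (intro integrableI_nonneg) (auto intro: le_less_trans)
  show "(\<integral>\<omega>. max 1 (X \<omega>) * \<bar>ln (X \<omega>)\<bar> \<partial>M)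
      \<le> enn2real (\<integral>\<^sup>+t. ennreal (log_integrand 1 G t) \<partial>radial_measure \<alpha>)"
    using le fin by (subst integral_eq_nn_integral) (auto intro!: enn2real_mono)
  show "integrable M X"
  proof (rule Bochner_Integration.integrable_bound)
    show "integrable M (\<lambda>\<omega>. exp 1 + max 1 (X \<omega>) * \<bar>ln (X \<omega>)\<bar>)"
      using int by simp
    show "AE \<omega> in M. norm (X \<omega>) \<le> norm (exp 1 + max 1 (X \<omega>) * \<bar>ln (X \<omega>)\<bar>)"
    proof (rule AE_I2)
      fix \<omega> assume \<omega>: "\<omega> \<in> space M"
      note pos = assms(3)[OF \<omega>]
      \<comment> \<open>Above e the logarithm is at least 1, so the logarithmic moment controls X;
        up to e the constant does.\<close>
      have "X \<omega> \<le> exp 1 + max 1 (X \<omega>) * \<bar>ln (X \<omega>)\<bar>"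
      proof (cases "X \<omega> \<le> exp 1")
        case True
        then show ?thesis by (rule order_trans) simp
      next
        case False
        then have "1 \<le> \<bar>ln (X \<omega>)\<bar>"
          using pos ln_ge_iff[of "X \<omega>" 1] by linarith
        then have "X \<omega> * 1 \<le> max 1 (X \<omega>) * \<bar>ln (X \<omega>)\<bar>"
          using pos by (intro mult_mono) auto
        also have "\<dots> \<le> exp 1 + max 1 (X \<omega>) * \<bar>ln (X \<omega>)\<bar>" by simp
        finally show ?thesis by simp
      qed
      then show "norm (X \<omega>) \<le> norm (exp 1 + max 1 (X \<omega>) * \<bar>ln (X \<omega>)\<bar>)"
        using pos by simp
    qed
  qed simp
qed

text \<open>A coupling on \<open>M1\<close>: Z2 is replaced by a coordinate-wise power of Z1 with
  the same law, and h is estimated pathwise. The bound \<open>J\<close> can be common to all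
  coordinates because all margins have the same Frechet law.\<close>

lemma max_stable_wasserstein_le:
  fixes \<nu> :: "(real ^ 'n) measure"
  assumes "is_norm nrm" "angular_measure nrm \<nu>" "1 < \<alpha>1" "\<alpha>1 < \<alpha>2"
    and ms: "max_stable \<alpha>1 \<nu> M1 Z1" "max_stable \<alpha>2 \<nu> M2 Z2"
    and moment: "\<And>j. integrable M1 (\<lambda>\<omega>. max 1 (Z1 \<omega> $ j) * \<bar>ln (Z1 \<omega> $ j)\<bar>)"
      "\<And>j. (\<integral>\<omega>. max 1 (Z1 \<omega> $ j) * \<bar>ln (Z1 \<omega> $ j)\<bar> \<partial>M1) \<le> J"
    and Z1_int: "\<And>j. integrable M1 (\<lambda>\<omega>. Z1 \<omega> $ j)"
  shows "wasserstein_dist M1 Z1 M2 Z2 \<le> ennreal (real CARD('n) * ((1 - \<alpha>1 / \<alpha>2) * J))"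
  unfolding wasserstein_dist_def
proof (rule SUP_least, rule ennreal_leI)
  interpret prob_space M1 using ms by (simp add: max_stable_def)
  note meas [measurable] = max_stable_measurable[OF ms(1)] max_stable_measurable[OF ms(2)]
  define c where "c = \<alpha>1 / \<alpha>2"
  have c: "0 < c" "c \<le> 1" using assms by (simp_all add: c_def)
  define T where "T \<omega> = (\<chi> j. (Z1 \<omega> $ j) powr c)" for \<omega>
  have T [measurable]: "T \<in> borel_measurable M1" unfolding T_def[abs_def] by measurable
  fix h :: "real ^ 'n \<Rightarrow> real" assume "h \<in> {h. lipschitz1 h}"
  then have h: "lipschitz1 h" by simp
  define h' where "h' x = h (\<chi> j. max 0 (x $ j))" for x
  have h' [measurable]: "h' \<in> borel_measurable borel"
    unfolding h'_def[abs_def] by (rule lipschitz1_clamp_measurable[OF h])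
  have h'_eq: "h x = h' x" if "x \<in> nonneg_orthant" for x
  proof -
    have "(\<chi> j. max 0 (x $ j)) = x"
      using that by (simp add: nonneg_orthant_def vec_eq_iff max_absorb2)
    then show ?thesis by (simp add: h'_def)
  qed
  have nn: "Z1 \<omega> \<in> nonneg_orthant" "T \<omega> \<in> nonneg_orthant" if "\<omega> \<in> space M1" for \<omega>
    using max_stable_pos[OF ms(1) that] by (auto simp: nonneg_orthant_def T_def less_imp_le)
  have nn2: "Z2 \<omega> \<in> nonneg_orthant" if "\<omega> \<in> space M2" for \<omega>
    using max_stable_pos[OF ms(2) that] by (auto simp: nonneg_orthant_def less_imp_le)
  have diff: "\<bar>Z1 \<omega> $ j - T \<omega> $ j\<bar> \<le> (1 - c) * (max 1 (Z1 \<omega> $ j) * \<bar>ln (Z1 \<omega> $ j)\<bar>)"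
    if "\<omega> \<in> space M1" for \<omega> j
    using abs_diff_powr_le[OF max_stable_pos[OF ms(1) that, of j] c] by (simp add: T_def)
  have diff_int: "integrable M1 (\<lambda>\<omega>. \<bar>Z1 \<omega> $ j - T \<omega> $ j\<bar>)" for j
    using diff
    by (intro Bochner_Integration.integrable_bound[OF integrable_mult_right[OF moment(1)[of j], of "1 - c"]])
       (auto intro!: AE_I2 order_trans[OF diff abs_ge_self])
  have h'_int: "integrable M1 (\<lambda>\<omega>. h' (Z1 \<omega>))"
  proof (rule Bochner_Integration.integrable_bound)
    show "integrable M1 (\<lambda>\<omega>. \<bar>h' 0\<bar> + (\<Sum>j\<in>UNIV. Z1 \<omega> $ j))"
      using Z1_int by simp
    show "AE \<omega> in M1. norm (h' (Z1 \<omega>)) \<le> norm (\<bar>h' 0\<bar> + (\<Sum>j\<in>UNIV. Z1 \<omega> $ j))"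
    proof (rule AE_I2)
      fix \<omega> assume \<omega>: "\<omega> \<in> space M1"
      have z0: "(0 :: real ^ 'n) \<in> nonneg_orthant" by (simp add: nonneg_orthant_def)
      have "\<bar>h (Z1 \<omega>) - h 0\<bar> \<le> (\<Sum>j\<in>UNIV. \<bar>Z1 \<omega> $ j - 0 $ j\<bar>)"
        using h nn[OF \<omega>] z0 unfolding lipschitz1_def by blast
      also have "\<dots> = (\<Sum>j\<in>UNIV. Z1 \<omega> $ j)"
        using max_stable_pos[OF ms(1) \<omega>] by (simp add: less_imp_le)
      finally show "norm (h' (Z1 \<omega>)) \<le> norm (\<bar>h' 0\<bar> + (\<Sum>j\<in>UNIV. Z1 \<omega> $ j))"
        unfolding h'_eq[OF nn(1)[OF \<omega>]] h'_eq[OF z0] by simp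
    qed
  qed simp
  have lip: "\<bar>h' (Z1 \<omega>) - h' (T \<omega>)\<bar> \<le> (\<Sum>j\<in>UNIV. \<bar>Z1 \<omega> $ j - T \<omega> $ j\<bar>)" if "\<omega> \<in> space M1" for \<omega>
    using h nn[OF that] unfolding lipschitz1_def by (simp add: h'_eq)
  \<comment> \<open>The Lipschitz bound dominates this difference. Subtracting it from h'(Z1) yields
    the integrability of h'(T), which spares a moment bound for T.\<close>
  have d_int: "integrable M1 (\<lambda>\<omega>. h' (Z1 \<omega>) - h' (T \<omega>))"
  proof (rule Bochner_Integration.integrable_bound)
    show "integrable M1 (\<lambda>\<omega>. \<Sum>j\<in>UNIV. \<bar>Z1 \<omega> $ j - T \<omega> $ j\<bar>)"
      by (intro Bochner_Integration.integrable_sum diff_int)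
    show "AE \<omega> in M1. norm (h' (Z1 \<omega>) - h' (T \<omega>)) \<le> norm (\<Sum>j\<in>UNIV. \<bar>Z1 \<omega> $ j - T \<omega> $ j\<bar>)"
      unfolding real_norm_def by (intro AE_I2 order_trans[OF lip abs_ge_self])
  qed simp
  have T_int: "integrable M1 (\<lambda>\<omega>. h' (T \<omega>))"
    using Bochner_Integration.integrable_diff[OF h'_int d_int] by simp
  \<comment> \<open>Measurability of \<open>h'\<close> allows the passage to the laws, where Z2 and
    T agree.\<close>
  have "(\<integral>\<omega>. h (Z2 \<omega>) \<partial>M2) = (\<integral>\<omega>. h' (Z2 \<omega>) \<partial>M2)"
    by (intro Bochner_Integration.integral_cong) (auto simp: h'_eq nn2)
  also have "\<dots> = (\<integral>x. h' x \<partial>distr M2 borel Z2)"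
    by (subst integral_distr) auto
  also have "\<dots> = (\<integral>x. h' x \<partial>distr M1 borel T)"
    using max_stable_distr_powr[OF assms(1,2) _ _ ms] assms by (simp add: T_def[abs_def] c_def)
  also have "\<dots> = (\<integral>\<omega>. h' (T \<omega>) \<partial>M1)"
    by (subst integral_distr) auto
  finally have "(\<integral>\<omega>. h (Z1 \<omega>) \<partial>M1) - (\<integral>\<omega>. h (Z2 \<omega>) \<partial>M2) = (\<integral>\<omega>. h' (Z1 \<omega>) - h' (T \<omega>) \<partial>M1)"
    using h'_int T_int nn(1)
    by (simp add: Bochner_Integration.integral_cong[OF refl h'_eq[OF nn(1)]])
  also have "\<bar>\<dots>\<bar> \<le> (\<integral>\<omega>. \<bar>h' (Z1 \<omega>) - h' (T \<omega>)\<bar> \<partial>M1)"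
    by (rule integral_abs_bound)
  also have "\<dots> \<le> (\<integral>\<omega>. (\<Sum>j\<in>UNIV. (1 - c) * (max 1 (Z1 \<omega> $ j) * \<bar>ln (Z1 \<omega> $ j)\<bar>)) \<partial>M1)"
  proof (rule integral_mono)
    fix \<omega> assume \<omega>: "\<omega> \<in> space M1"
    show "\<bar>h' (Z1 \<omega>) - h' (T \<omega>)\<bar> \<le> (\<Sum>j\<in>UNIV. (1 - c) * (max 1 (Z1 \<omega> $ j) * \<bar>ln (Z1 \<omega> $ j)\<bar>))"
      using lip[OF \<omega>] sum_mono[OF diff[OF \<omega>]] by (rule order_trans)
  qed (use d_int moment(1) in auto)
  also have "\<dots> = (\<Sum>j\<in>UNIV. (1 - c) * (\<integral>\<omega>. max 1 (Z1 \<omega> $ j) * \<bar>ln (Z1 \<omega> $ j)\<bar> \<partial>M1))"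
    using moment(1) by (simp add: Bochner_Integration.integral_sum)
  also have "\<dots> \<le> (\<Sum>j\<in>(UNIV :: 'n set). (1 - c) * J)"
    using moment(2) c by (intro sum_mono mult_left_mono) auto
  finally show "\<bar>(\<integral>\<omega>. h (Z1 \<omega>) \<partial>M1) - (\<integral>\<omega>. h (Z2 \<omega>) \<partial>M2)\<bar> \<le> real CARD('n) * ((1 - \<alpha>1 / \<alpha>2) * J)"
    by (simp add: c_def)
qed

section \<open>Both distance bounds with the explicit constants\<close>

theorem theorem8:
  fixes nrm :: "real ^ 'n \<Rightarrow> real"
    and \<nu> :: "(real ^ 'n) measure"
    and \<alpha>1 \<alpha>2 :: real
    and M1 :: "'a measure" and Z1 :: "'a \<Rightarrow> real ^ 'n"
    and M2 :: "'b measure" and Z2 :: "'b \<Rightarrow> real ^ 'n"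
    and M :: "'c measure" and \<zeta> :: "'c \<Rightarrow> real"
  assumes "is_norm nrm"
    and "sphere_plus nrm \<subseteq> {x. \<forall>j. 0 \<le> x $ j \<and> x $ j \<le> 1}"
    and "angular_measure nrm \<nu>"
    and "0 < \<alpha>1" and "\<alpha>1 < \<alpha>2"
    and "max_stable \<alpha>1 \<nu> M1 Z1"
    and "max_stable \<alpha>2 \<nu> M2 Z2"
    and "frechet \<alpha>1 M \<zeta>"
  shows "((\<forall>j. integrable (exponent_measure \<alpha>1 \<nu>) (K_integrand \<alpha>1 \<alpha>2 M \<zeta> j)) \<and>
          kolmogorov_dist M1 Z1 M2 Z2
            \<le> C_K \<alpha>1 \<alpha>2 \<nu> M \<zeta> * (1 / \<alpha>1 + 1 / \<alpha>2) * \<bar>\<alpha>1 - \<alpha>2\<bar>) \<and>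
         (1 < \<alpha>1 \<and> 1 < \<alpha>2 \<longrightarrow>
           (\<forall>j. integrable (exponent_measure \<alpha>1 \<nu>) (W_integrand \<alpha>1 \<alpha>2 M \<zeta> j)) \<and>
           0 < C_W \<alpha>1 \<alpha>2 \<nu> M \<zeta> \<and>
           wasserstein_dist M1 Z1 M2 Z2
             \<le> ennreal (C_W \<alpha>1 \<alpha>2 \<nu> M \<zeta> * (1 / \<alpha>1 + 1 / \<alpha>2) * \<bar>\<alpha>1 - \<alpha>2\<bar>))"
proof -
  let ?G = "min_frechet_cdf \<alpha>1 \<alpha>2 M \<zeta>"
  let ?J = "\<lambda>\<kappa>. enn2real (\<integral>\<^sup>+t. ennreal (log_integrand \<kappa> ?G t) \<partial>radial_measure \<alpha>1)"
  have G [measurable]: "?G \<in> borel_measurable borel"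
    by (intro borel_measurable_mono mono_min_frechet_cdf[OF assms(8)])
  \<comment> \<open>The Kolmogorov constant takes kappa = 0, available for every alpha1 > 0; the
    Wasserstein constant takes kappa = 1, which asks for alpha1 > 1.\<close>
  have fin: "(\<integral>\<^sup>+t. ennreal (log_integrand \<kappa> ?G t) \<partial>radial_measure \<alpha>1) < \<infinity>" if "\<kappa> < \<alpha>1" for \<kappa>
    using assms that
    by (intro nn_integral_log_integrand_finite[where \<gamma>="\<alpha>1\<^sup>2 / \<alpha>2"] G min_frechet_cdf_nonneg
        min_frechet_cdf_le_1[OF assms(8)] min_frechet_cdf_le_exp[OF assms(8)]) auto
  \<comment> \<open>By the margin formula the integrals do not depend on j; integrability makes them
    genuine values rather than the default 0.\<close>
  have nth: "integrable (exponent_measure \<alpha>1 \<nu>) (\<lambda>y. log_integrand \<kappa> ?G (y $ j))"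
    "(\<integral>y. log_integrand \<kappa> ?G (y $ j) \<partial>exponent_measure \<alpha>1 \<nu>) = ?J \<kappa>" if "\<kappa> < \<alpha>1" for \<kappa> j
    using exponent_measure_integral_nth[OF assms(1,3,4), of "log_integrand \<kappa> ?G" j] fin[OF that]
    by (auto simp: log_integrand_nonneg min_frechet_cdf_nonneg) (auto simp: log_integrand_def)
  have K: "K_integrand \<alpha>1 \<alpha>2 M \<zeta> j = (\<lambda>y. log_integrand 0 ?G (y $ j))" for j :: 'n
    by (auto simp: K_integrand_def log_integrand_def)
  have W: "W_integrand \<alpha>1 \<alpha>2 M \<zeta> j = (\<lambda>y. log_integrand 1 ?G (y $ j))" for j :: 'n
    by (auto simp: W_integrand_def log_integrand_def)
  have factor: "(1 / \<alpha>1 + 1 / \<alpha>2) * \<bar>\<alpha>1 - \<alpha>2\<bar> = \<alpha>2 / \<alpha>1 - \<alpha>1 / \<alpha>2"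
    using assms by (simp add: field_simps)
  have frac: "\<alpha>1 / \<alpha>2 < 1" "1 < \<alpha>2 / \<alpha>1"
    using assms by simp_all
  have "\<alpha>1 / \<alpha>2 \<le> \<alpha>2 / \<alpha>1"
    using frac by linarith
  note frac = frac this
  have J: "0 \<le> ?J \<kappa>" for \<kappa> by simp
  have "kolmogorov_dist M1 Z1 M2 Z2 \<le> real CARD('n) * (\<alpha>2 / \<alpha>1 - \<alpha>1 / \<alpha>2)"
    by (rule max_stable_kolmogorov_le[OF assms(1,3,4,5,6,7)])
  \<comment> \<open>The integrals in the constant are nonnegative and are discarded.\<close>
  also have "\<dots> \<le> C_K \<alpha>1 \<alpha>2 \<nu> M \<zeta> * (\<alpha>2 / \<alpha>1 - \<alpha>1 / \<alpha>2)"
    using frac assms(4) J[of 0] by (intro mult_right_mono) (auto simp: C_K_def K nth)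
  finally have "kolmogorov_dist M1 Z1 M2 Z2 \<le> C_K \<alpha>1 \<alpha>2 \<nu> M \<zeta> * (1 / \<alpha>1 + 1 / \<alpha>2) * \<bar>\<alpha>1 - \<alpha>2\<bar>"
    by (simp only: mult.assoc factor)
  moreover have "0 < C_W \<alpha>1 \<alpha>2 \<nu> M \<zeta>"
    "wasserstein_dist M1 Z1 M2 Z2 \<le> ennreal (C_W \<alpha>1 \<alpha>2 \<nu> M \<zeta> * (1 / \<alpha>1 + 1 / \<alpha>2) * \<bar>\<alpha>1 - \<alpha>2\<bar>)"
    if \<alpha>1: "1 < \<alpha>1"
  proof -
    have CW: "C_W \<alpha>1 \<alpha>2 \<nu> M \<zeta> = real CARD('n) * Gamma (1 - 1 / \<alpha>1) + real CARD('n) * ?J 1"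
      using \<alpha>1 by (simp add: C_W_def W nth)
    have \<Gamma>: "0 < Gamma (1 - 1 / \<alpha>1)"
      using \<alpha>1 by (intro Gamma_real_pos) simp
    then show "0 < C_W \<alpha>1 \<alpha>2 \<nu> M \<zeta>"
      unfolding CW using J[of 1] by (intro add_pos_nonneg) auto
    note m = frechet_log_moment[OF \<alpha>1 max_stable_frechet[OF assms(1,3,4,6)] _ G min_frechet_cdf_nonneg
        min_frechet_cdf_ge[OF assms(8)] fin[OF \<alpha>1]]
    have "wasserstein_dist M1 Z1 M2 Z2 \<le> ennreal (real CARD('n) * ((1 - \<alpha>1 / \<alpha>2) * ?J 1))"
      by (intro max_stable_wasserstein_le[OF assms(1,3) \<alpha>1 assms(5,6,7)] m max_stable_pos[OF assms(6)])
    also have "\<dots> \<le> ennreal (C_W \<alpha>1 \<alpha>2 \<nu> M \<zeta> * (\<alpha>2 / \<alpha>1 - \<alpha>1 / \<alpha>2))"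
    proof (rule ennreal_leI)
      have "real CARD('n) * ((1 - \<alpha>1 / \<alpha>2) * ?J 1) = real CARD('n) * ?J 1 * (1 - \<alpha>1 / \<alpha>2)"
        by simp
      \<comment> \<open>The Gamma term is positive, and 1 - 1/beta <= beta - 1/beta because beta >
        1.\<close>
      also have "\<dots> \<le> C_W \<alpha>1 \<alpha>2 \<nu> M \<zeta> * (\<alpha>2 / \<alpha>1 - \<alpha>1 / \<alpha>2)"
        unfolding CW using \<Gamma> J[of 1] frac by (intro mult_mono) auto
      finally show "real CARD('n) * ((1 - \<alpha>1 / \<alpha>2) * ?J 1) \<le> C_W \<alpha>1 \<alpha>2 \<nu> M \<zeta> * (\<alpha>2 / \<alpha>1 - \<alpha>1 / \<alpha>2)" .
    qed
    finally show "wasserstein_dist M1 Z1 M2 Z2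
        \<le> ennreal (C_W \<alpha>1 \<alpha>2 \<nu> M \<zeta> * (1 / \<alpha>1 + 1 / \<alpha>2) * \<bar>\<alpha>1 - \<alpha>2\<bar>)"
      by (simp only: mult.assoc factor)
  qed
  ultimately show ?thesis
    using nth assms(4) by (simp add: K W)
qed

end
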